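(* Let $q=2^r$ with $r\ge1$, and let $t_1,t_2,t_3\in\mathbb{F}_q$. Then $$\psi_q(24,t_1,t_2,t_3)=q^{21}-q^{10}\left(2q^2\cdot 1_{t_1=t_2=t_3=0}-q\cdot 1_{t_1=t_2=0}-1_{t_1=0}\right).$$
   Context: $\mathbb{F}_q$ is the finite field with $q$ elements; $\mathcal{M}_{n,q}$ is the set of monic polynomials of degree $n$ in $\mathbb{F}_q[T]$. The $j$-th next-to-leading coefficient of a monic polynomial $f$ of degree $n$ is the coefficient of $T^{n-j}$ in $f$. The von Mangoldt function is $\Lambda_q(f)=\deg P$ if $f=P^k$ with $P$ monic irreducible and $k\ge1$, and $\Lambda_q(f)=0$ otherwise. $\psi_q(n,t_1,t_2,t_3)=\sum \Lambda_q(f)$, the sum being over all $f\in\mathcal{M}_{n,q}$ whose first $3$ next-to-leading coefficients are $t_1,t_2,t_3$. $1_{E}$ equals $1$ if the condition $E$ holds and $0$ otherwise. *)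

theory Defs
  imports "HOL-Computational_Algebra.Computational_Algebra" "HOL-Library.Cardinality"
begin

definition monic_polys :: "nat \<Rightarrow> 'a::field poly set" where
  "monic_polys n = {f. lead_coeff f = 1 \<and> degree f = n}"

text \<open>Only \<open>j \<le> degree f\<close> is meaningful; the guard prevents truncated
  subtraction from returning the constant coefficient for larger \<open>j\<close>.\<close>
definition next_to_leading_coeff :: "nat \<Rightarrow> 'a::field poly \<Rightarrow> 'a" where
  "next_to_leading_coeff j f = (if j \<le> degree f then coeff f (degree f - j) else 0)"

definition is_monic_prime_power :: "'a::field poly \<Rightarrow> 'a poly \<Rightarrow> bool" where
  "is_monic_prime_power f P \<longleftrightarrow>
     lead_coeff P = 1 \<and> irreducible P \<and> (\<exists>k\<ge>1. f = P ^ k)"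

text \<open>The description is well defined: by unique factorisation, at most one monic
  irreducible polynomial has \<open>f\<close> among its positive powers.\<close>
definition poly_mangoldt :: "'a::field poly \<Rightarrow> nat" where
  "poly_mangoldt f =
     (if \<exists>P. is_monic_prime_power f P
      then degree (THE P. is_monic_prime_power f P) else 0)"

text \<open>The summation range is finite because the coefficient field is.\<close>
definition psi :: "nat \<Rightarrow> 'a::{field,finite} \<Rightarrow> 'a \<Rightarrow> 'a \<Rightarrow> nat" where
  "psi n t\<^sub>1 t\<^sub>2 t\<^sub>3 =
     (\<Sum>f | f \<in> monic_polys n \<and> next_to_leading_coeff 1 f = t\<^sub>1 \<and>
            next_to_leading_coeff 2 f = t\<^sub>2 \<and> next_to_leading_coeff 3 f = t\<^sub>3.
        poly_mangoldt f)"

end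

theory Submission
  imports "HOL-Algebra.Algebraic_Closure_Type" Defs
begin

text \<open>
  Let \<open>q = 2\<^sup>r\<close>, and write \<open>K\<close> for the extension of degree 24 of the base field \<open>F\<close>. An element of
  \<open>K\<close> has as its characteristic polynomial over \<open>F\<close> a power of a monic irreducible polynomial, and a
  monic \<open>f\<close> of degree 24 is the characteristic polynomial of exactly \<open>\<Lambda>(f)\<close> elements of \<open>K\<close> (lemma
  \<open>card_orbit_poly_fibre\<close>). Hence \<open>\<psi>\<close> counts the \<open>\<alpha> \<in> K\<close> whose conjugates have prescribed elementary
  symmetric functions \<open>e\<^sub>1, e\<^sub>2, e\<^sub>3\<close> (lemma \<open>psi_eq_card\<close>).

  In characteristic 2, Newton's identity reads \<open>e\<^sub>3 = p\<^sub>3 + e\<^sub>1\<^sup>3 + e\<^sub>1 e\<^sub>2\<close>, so \<open>e\<^sub>3\<close> may be replaced by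
  the power sum \<open>p\<^sub>3 = Tr \<alpha>\<^sup>3\<close>. Fourier inversion on \<open>F\<^sup>3\<close> reduces the count to the sums of
  \<open>\<chi>(c\<^sub>1 Tr \<alpha> + c\<^sub>2 e\<^sub>2(\<alpha>) + c\<^sub>3 Tr \<alpha>\<^sup>3)\<close> over \<open>\<alpha> \<in> K\<close>, where \<open>\<chi>\<close> is the standard additive character of
  \<open>F\<close>. Since \<open>\<alpha>\<^sup>3 = \<alpha> \<cdot> \<alpha>\<^sup>2\<close> and squaring is additive, these are sums of signs of quadratic functions
  over the prime field, and they can be evaluated exactly.

  Let \<open>W\<close> be the subfield over which \<open>K\<close> has degree 2, and \<open>K = W + W \<theta>\<close> with \<open>\<theta>\<close> of relative trace 1 and
  \<open>\<delta> = \<theta>\<^sup>2 + \<theta>\<close>. For fixed \<open>b\<close> the exponent at \<open>w + b \<theta>\<close> is affine in \<open>w\<close>, and its linear part is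
  the trace of \<open>D w\<^sup>2\<close> with \<open>D = e (1 + b\<^sup>2 e)\<close> and \<open>e = c\<^sub>2 + c\<^sub>3 b\<close> (lemma \<open>trace_decomp\<close>). So only those
  \<open>b\<close> contribute for which \<open>e = 0\<close> or \<open>b\<^sup>2 e = 1\<close>. When \<open>c\<^sub>2\<close> and \<open>c\<^sub>3\<close> are not both zero,
  these \<open>b\<close> have degree at most 3 over \<open>F\<close>, the remaining exponent is the trace of \<open>b\<^sup>2 e \<delta>\<close>, and
  \<open>\<delta>\<close> has trace 1. Thus each contribution is \<open>1\<close> or \<open>-1\<close> according to whether \<open>b\<^sup>2 e\<close> is 0 or 1,
  and the sums are \<open>-2 q\<^sup>1\<^sup>2\<close> for \<open>c\<^sub>3 \<noteq> 0\<close> and \<open>-q\<^sup>1\<^sup>2\<close> for \<open>c\<^sub>3 = 0 \<noteq> c\<^sub>2\<close> (lemma \<open>char_sum_eval\<close>).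
  For \<open>c\<^sub>2 = c\<^sub>3 = 0\<close> the sum is \<open>q\<^sup>2\<^sup>4\<close> or 0 by orthogonality of characters.
\<close>

section \<open>Finite fields of characteristic 2 and their additive characters\<close>

lemma card_roots_separable:
  fixes p :: "'b::alg_closed_field poly"
  assumes sep: "\<And>x. poly p x = 0 \<Longrightarrow> poly (pderiv p) x \<noteq> 0" and nz: "p \<noteq> 0"
  shows "card {x. poly p x = 0} = degree p"
proof -
  obtain A where A: "size A = degree p" "p = smult (lead_coeff p) (\<Prod>x\<in>#A. [:-x, 1:])"
    using alg_closed_imp_factorization[OF nz] by blast
  have roots: "{x. poly p x = 0} = set_mset A"
  proof -
    have "poly p x = 0 \<longleftrightarrow> x \<in># A" for x
    proof -
      have "poly (\<Prod>x\<in>#A. [:-x, 1:]) x = 0 \<longleftrightarrow> x \<in># A"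
        by (induction A) auto
      then show ?thesis
        by (subst A(2)) (use nz in simp)
    qed
    then show ?thesis by auto
  qed
  have "count A x \<le> 1" for x
  proof (rule ccontr)
    assume "\<not> count A x \<le> 1"
    then have "{#x, x#} \<subseteq># A"
      by (auto simp: subseteq_mset_def)
    then obtain B where B: "A = {#x, x#} + B"
      by (meson mset_subset_eq_exists_conv)
    define g where "g = smult (lead_coeff p) (\<Prod>x\<in>#B. [:-x, 1:])"
    have "p = [:-x, 1:] * ([:-x, 1:] * g)"
      by (subst A(2)) (simp add: B g_def mult.assoc)
    moreover from this have "poly (pderiv p) x = 0"
      by (simp only: pderiv_mult) simp
    ultimately show False using sep[of x] by simp
  qed
  then have "A = mset_set (set_mset A)"
    by (intro multiset_eqI) (metis count_mset_set(1) count_mset_set(3) finite_set_mset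
        le_less less_one not_in_iff)
  then have "size A = card (set_mset A)"
    by (metis size_mset_set)
  then show ?thesis using roots A(1) by simp
qed

text \<open>The field with \<open>2\<^sup>n\<close> elements, realised inside an algebraically closed field of
  characteristic 2 as the fixed points of the \<open>n\<close>-th iterate of squaring. For \<open>n = 0\<close> this is
  the whole field.\<close>

definition GF :: "nat \<Rightarrow> 'b::comm_semiring_1 set" where
  "GF n = {x. x ^ (2 ^ n) = x}"

text \<open>The absolute trace from \<open>GF n\<close> to the prime field, as a polynomial expression that makes
  sense for every element of the ambient field.\<close>

definition trace2 :: "nat \<Rightarrow> 'b::comm_semiring_1 \<Rightarrow> 'b" where
  "trace2 n x = (\<Sum>i<n. x ^ (2 ^ i))"

text \<open>The sign \<open>(-1)\<^sup>t\<close> of a bit \<open>t\<close>; it is only meant for \<open>t \<in> {0, 1}\<close>.\<close>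

definition bit_sign :: "'b::zero \<Rightarrow> int" where
  "bit_sign t = (if t = 0 then 1 else -1)"

text \<open>The standard nontrivial additive character of \<open>GF n\<close>.\<close>

definition chi :: "nat \<Rightarrow> 'b::comm_semiring_1 \<Rightarrow> int" where
  "chi n x = bit_sign (trace2 n x)"

text \<open>Characteristic 2 is recorded by \<open>2 = 0\<close>, and the parameter \<open>ty\<close> only names the type.
  Subtraction is then addition, and the rules below rewrite accordingly.\<close>

locale char_two =
  fixes ty :: "'b::alg_closed_field itself"
  assumes two_eq_0: "(2::'b) = 0"
begin

lemma add_self [simp]: "x + x = (0::'b)"
  by (metis mult_2 mult_zero_left two_eq_0)

lemma add_self_left [simp]: "x + (x + y) = (y::'b)"
  by (metis add.assoc add_0 add_self)

lemma uminus_char2 [simp]: "- x = (x::'b)"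
  by (rule minus_unique) simp

lemma minus_char2 [simp]: "x - y = x + (y::'b)"
  by (metis add_uminus_conv_diff uminus_char2)

lemma add_eq_0_char2 [simp]: "x + y = 0 \<longleftrightarrow> x = (y::'b)"
  by (metis minus_char2 right_minus_eq)

lemma pow2_add: "(x + y) ^ (2 ^ n) = x ^ (2 ^ n) + (y::'b) ^ (2 ^ n)"
proof (induction n arbitrary: x y)
  case (Suc n)
  have "(x + y) ^ 2 = x ^ 2 + y ^ 2"
    by (simp add: power2_eq_square algebra_simps)
  then have "((x + y) ^ 2) ^ (2 ^ n) = (x ^ 2) ^ (2 ^ n) + (y ^ 2) ^ (2 ^ n)"
    using Suc[of "x^2" "y^2"] by simp
  then show ?case by (simp flip: power_mult)
qed simp

lemma square_add: "(x + y)\<^sup>2 = x\<^sup>2 + (y::'b)\<^sup>2"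
  using pow2_add[of x y 1] by simp

lemma pow2_sum: "(\<Sum>i\<in>I. f i) ^ (2 ^ n) = (\<Sum>i\<in>I. (f i :: 'b) ^ (2 ^ n))"
  by (induction I rule: infinite_finite_induct) (auto simp: pow2_add)

lemma pow2_inj: "x ^ (2 ^ n) = y ^ (2 ^ n) \<longleftrightarrow> x = (y::'b)"
proof
  assume "x ^ (2 ^ n) = y ^ (2 ^ n)"
  then have "(x + y) ^ (2 ^ n) = 0" by (simp add: pow2_add)
  then show "x = y" by simp
qed simp

lemma GF_0 [simp]: "(0::'b) \<in> GF n" and GF_1 [simp]: "(1::'b) \<in> GF n"
  by (auto simp: GF_def zero_power)

lemma GF_add [simp]: "x \<in> GF n \<Longrightarrow> y \<in> GF n \<Longrightarrow> x + y \<in> GF n" for x y :: 'b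
  by (auto simp: GF_def pow2_add)

lemma GF_mult [simp]: "x \<in> GF n \<Longrightarrow> y \<in> GF n \<Longrightarrow> x * y \<in> GF n" for x y :: 'b
  by (auto simp: GF_def power_mult_distrib)

lemma GF_power [simp]: "x \<in> GF n \<Longrightarrow> x ^ k \<in> GF n" for x :: 'b
  by (induction k) auto

lemma GF_divide [simp]: "x \<in> GF n \<Longrightarrow> y \<in> GF n \<Longrightarrow> x / y \<in> GF n" for x y :: 'b
  by (auto simp: GF_def power_divide)

lemma GF_mult_power: "x \<in> GF n \<Longrightarrow> x ^ (2 ^ (n * k)) = x" for x :: 'b
  by (induction k) (auto simp: GF_def power_add power_mult)

lemma GF_mono: "x \<in> GF n \<Longrightarrow> n dvd m \<Longrightarrow> x \<in> GF m" for x :: 'b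
  by (auto elim!: dvdE simp: GF_mult_power) (simp add: GF_def GF_mult_power)

lemma card_GF: "n > 0 \<Longrightarrow> card (GF n :: 'b set) = 2 ^ n"
proof -
  assume n: "n > 0"
  define p :: "'b poly" where "p = monom 1 (2 ^ n) + monom 1 1"
  have deg: "degree p = 2 ^ n"
    unfolding p_def using n
    by (subst degree_add_eq_left) (auto simp: degree_monom_eq intro!: one_less_power[where n = n, of "2::nat", simplified])
  have pd: "pderiv p = 1"
    using n two_eq_0 by (simp add: p_def pderiv_add pderiv_monom one_pCons monom_0)
  have "card {x. poly p x = 0} = degree p"
    using deg by (intro card_roots_separable) (auto simp: pd)
  moreover have "{x. poly p x = 0} = GF n"
    by (auto simp: p_def poly_monom GF_def)
  ultimately show ?thesis using deg by simp
qed

lemma finite_GF: "n > 0 \<Longrightarrow> finite (GF n :: 'b set)"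
  by (rule card_ge_0_finite) (simp add: card_GF)

lemma trace2_0 [simp]: "trace2 n (0::'b) = 0"
  by (simp add: trace2_def zero_power)

lemma trace2_add: "trace2 n (x + y) = trace2 n x + trace2 n (y::'b)"
  by (simp add: trace2_def pow2_add sum.distrib)

lemma trace2_plus: "trace2 (m + n) x = trace2 m x + trace2 n (x ^ (2 ^ m))" for x :: 'b
  unfolding trace2_def
  by (induction n) (simp_all add: power_add add.assoc flip: power_mult)

text \<open>The trace of an element of \<open>GF n\<close>, taken from an extension of degree 2, vanishes; taken from an
  extension of degree 3, it is the trace from \<open>GF n\<close> itself.\<close>

lemma trace2_double: "x \<in> GF n \<Longrightarrow> trace2 (2 * n) x = 0" for x :: 'b
  using trace2_plus[of n n x] by (simp add: GF_def flip: mult_2)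

lemma trace2_triple: "x \<in> GF n \<Longrightarrow> trace2 (3 * n) x = trace2 n x" for x :: 'b
  using trace2_plus[of n "2 * n" x] trace2_double[of x n] by (simp add: GF_def)

text \<open>This telescoping identity needs no membership assumption. It shows that the trace is invariant
  under squaring on \<open>GF n\<close>, and it computes the conjugates of a root of \<open>X\<^sup>2 + X + \<delta>\<close>.\<close>

lemma trace2_shift: "trace2 n (x\<^sup>2) + x = trace2 n x + x ^ (2 ^ n)" for x :: 'b
  by (induction n) (simp_all add: trace2_def add_ac flip: power_mult)

lemma trace2_square: "x \<in> GF n \<Longrightarrow> trace2 n (x\<^sup>2) = trace2 n x" for x :: 'b
  using trace2_shift[of n x] by (simp add: GF_def)

lemma trace2_power2: "(trace2 n x)\<^sup>2 = trace2 n (x\<^sup>2)" for x :: 'b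
  unfolding trace2_def using pow2_sum[of "\<lambda>i. x ^ 2 ^ i" "{..<n}" 1]
  by (simp add: mult.commute flip: power_mult)

lemma idempotent_cases: "x\<^sup>2 = x \<Longrightarrow> x = 0 \<or> x = 1" for x :: 'b
  by (simp add: power2_eq_square)

lemma trace2_cases: "x \<in> GF n \<Longrightarrow> trace2 n x = 0 \<or> trace2 n x = 1" for x :: 'b
  by (rule idempotent_cases) (simp add: trace2_power2 trace2_square)

lemma chi_0 [simp]: "chi n (0::'b) = 1"
  by (simp add: chi_def bit_sign_def)

lemma bit_sign_add:
  "s = 0 \<or> s = 1 \<Longrightarrow> t = 0 \<or> t = 1 \<Longrightarrow> bit_sign (s + t) = bit_sign s * bit_sign (t::'b)"
  by (auto simp: bit_sign_def)

lemma chi_add: "x \<in> GF n \<Longrightarrow> y \<in> GF n \<Longrightarrow> chi n (x + y) = chi n x * chi n y" for x y :: 'b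
  by (simp add: chi_def trace2_add bit_sign_add trace2_cases)

lemma exists_trace2_1:
  assumes "n > 0"
  obtains x :: 'b where "x \<in> GF n" "trace2 n x = 1"
proof -
  define p :: "'b poly" where "p = (\<Sum>i<n. monom 1 (2 ^ i))"
  have poly_p: "poly p x = trace2 n x" for x
    by (simp add: p_def trace2_def poly_sum poly_monom)
  have "coeff p 1 = (\<Sum>i<n. if i = 0 then 1 else 0)"
    unfolding p_def coeff_sum by (intro sum.cong) (auto simp: )
  then have "p \<noteq> 0" using assms by auto
  \<comment> \<open>The trace has too small a degree to vanish on all of \<open>GF n\<close>.\<close>
  have "degree p \<le> 2 ^ (n - 1)"
    unfolding p_def
    by (intro degree_sum_le) (auto intro!: order.trans[OF degree_monom_le] power_increasing)
  then have "card {x. poly p x = 0} < 2 ^ n"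
    using card_poly_roots_bound[OF \<open>p \<noteq> 0\<close>] assms
    by (metis One_nat_def diff_less le_less_trans lessI one_less_numeral_iff power_strict_increasing semiring_norm(76))
  then have "\<not> (GF n \<subseteq> {x. poly p x = 0})"
    using card_GF[OF assms] card_mono[OF poly_roots_finite[OF \<open>p \<noteq> 0\<close>]]
    by (metis linorder_not_less)
  then show ?thesis
    using that trace2_cases by (auto simp: poly_p)
qed

lemma sum_chi:
  fixes c :: 'b
  assumes "n > 0" "c \<in> GF n"
  shows "(\<Sum>x\<in>GF n. chi n (c * x)) = (if c = 0 then 2 ^ n else 0)"
proof (cases "c = 0")
  case True
  then show ?thesis using assms by (simp add: card_GF)
next
  case False
  obtain z :: 'b where z: "z \<in> GF n" "trace2 n z = 1"
    using exists_trace2_1 assms by blast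
  define y where "y = z / c"
  have y: "y \<in> GF n" "c * y = z" using z False assms by (auto simp: y_def)
  have "(\<Sum>x\<in>GF n. chi n (c * x)) = (\<Sum>x\<in>GF n. chi n (c * (x + y)))"
    by (rule sum.reindex_bij_witness[of _ "\<lambda>x. x + y" "\<lambda>x. x + y"]) (use y in \<open>auto simp: add.assoc\<close>)
  also have "\<dots> = (\<Sum>x\<in>GF n. - chi n (c * x))"
    by (intro sum.cong) (use y z assms in \<open>auto simp: distrib_left chi_add chi_def[of n z] bit_sign_def[of 1]\<close>)
  finally show ?thesis using False by (simp add: sum_negf)
qed

lemma sqrt_GF:
  fixes c :: 'b
  assumes "n > 0" "c \<in> GF n"
  obtains d where "d \<in> GF n" "d\<^sup>2 = c"
proof
  show "c ^ (2 ^ (n - 1)) \<in> GF n" using assms by simp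
  show "(c ^ (2 ^ (n - 1)))\<^sup>2 = c"
    using assms by (cases n) (auto simp: GF_def mult.commute simp flip: power_mult)
qed

end

section \<open>Elementary symmetric functions of conjugates\<close>

text \<open>The \<open>j\<close>-th elementary symmetric polynomial in \<open>x 0, \<dots>, x (n - 1)\<close>, read off from the
  generating function.\<close>

definition esym :: "nat \<Rightarrow> nat \<Rightarrow> (nat \<Rightarrow> 'b::comm_ring_1) \<Rightarrow> 'b" where
  "esym j n x = coeff (\<Prod>i<n. [:1, x i:]) j"

lemma esym_0 [simp]: "esym 0 n x = 1"
  by (induction n) (auto simp: esym_def coeff_mult_0)

lemma esym_Suc_0 [simp]: "esym (Suc j) 0 x = 0"
  by (simp add: esym_def)

lemma esym_Suc_Suc: "esym (Suc j) (Suc n) x = esym (Suc j) n x + x n * esym j n x"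
proof -
  have "(\<Prod>i<Suc n. [:1, x i:]) = (\<Prod>i<n. [:1, x i:]) + pCons 0 (smult (x n) (\<Prod>i<n. [:1, x i:]))"
    by (simp add: mult.commute)
  then show ?thesis by (simp add: esym_def)
qed

lemma esym_1: "esym 1 n x = (\<Sum>i<n. x i)"
  by (induction n) (auto simp: esym_Suc_Suc)

lemma esym_2_Suc: "esym 2 (Suc n) x = esym 2 n x + x n * (\<Sum>i<n. x i)"
  using esym_Suc_Suc[of 1 n x] by (simp add: numeral_2_eq_2 flip: esym_1)

lemma esym_3_Suc: "esym 3 (Suc n) x = esym 3 n x + x n * esym 2 n x"
  using esym_Suc_Suc[of 2 n x] by (simp add: numeral_3_eq_3)

lemma esym_2_0 [simp]: "esym 2 0 x = 0" and esym_3_0 [simp]: "esym 3 0 x = 0"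
  by (simp_all add: numeral_2_eq_2 numeral_3_eq_3)

text \<open>The hypothesis makes \<open>x 1, \<dots>, x n\<close> a cyclic rotation of \<open>x 0, \<dots>, x (n - 1)\<close>.\<close>

lemma esym_cyclic:
  assumes "x n = x 0"
  shows "esym j n (\<lambda>i. x (Suc i)) = esym j n x"
proof (cases n)
  case (Suc m)
  have "(\<Prod>i<Suc m. [:1, x (Suc i):]) = [:1, x n:] * (\<Prod>i<m. [:1, x (Suc i):])"
    by (simp add: Suc mult.commute)
  also have "\<dots> = (\<Prod>i<Suc m. [:1, x i:])"
    by (simp only: prod.lessThan_Suc_shift assms)
  finally show ?thesis by (simp add: esym_def Suc)
qed (simp add: esym_def)

text \<open>For \<open>x\<close> in \<open>GF (r * k)\<close>, the trace and the second elementary symmetric function of the \<open>k\<close>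
  conjugates of \<open>x\<close> over \<open>GF r\<close>. The second one is a quadratic form with polarisation
  \<open>rtrace x * rtrace y + rtrace (x * y)\<close> (lemma \<open>esq_add\<close>).\<close>

definition rtrace :: "nat \<Rightarrow> nat \<Rightarrow> 'b::comm_ring_1 \<Rightarrow> 'b" where
  "rtrace r k x = (\<Sum>i<k. x ^ (2 ^ (r * i)))"

definition esq :: "nat \<Rightarrow> nat \<Rightarrow> 'b::comm_ring_1 \<Rightarrow> 'b" where
  "esq r k x = esym 2 k (\<lambda>i. x ^ (2 ^ (r * i)))"

context char_two
begin

lemma esym_2_add:
  fixes x y :: "nat \<Rightarrow> 'b"
  shows "esym 2 n (\<lambda>i. x i + y i) =
    esym 2 n x + esym 2 n y + (\<Sum>i<n. x i) * (\<Sum>i<n. y i) + (\<Sum>i<n. x i * y i)"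
  by (induction n) (simp_all add: esym_2_Suc sum.distrib algebra_simps)

lemma esym_2_plus:
  fixes x :: "nat \<Rightarrow> 'b"
  shows "esym 2 (m + n) x =
    esym 2 m x + esym 2 n (\<lambda>i. x (m + i)) + (\<Sum>i<m. x i) * (\<Sum>i<n. x (m + i))"
proof -
  have s: "(\<Sum>i<m + n. x i) = (\<Sum>i<m. x i) + (\<Sum>i<n. x (m + i))" for n
    by (induction n) (simp_all add: add.assoc)
  show ?thesis
    by (induction n)
       (simp_all add: esym_2_Suc s distrib_left distrib_right
          add.assoc[where 'a = 'b] add.left_commute[where 'a = 'b] mult.commute[where 'a = 'b])
qed

text \<open>Newton's identity \<open>p\<^sub>3 = e\<^sub>1\<^sup>3 - 3 e\<^sub>1 e\<^sub>2 + 3 e\<^sub>3\<close> in characteristic 2. The coefficient of \<open>e\<^sub>3\<close>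
  is odd, so prescribing \<open>e\<^sub>1, e\<^sub>2, e\<^sub>3\<close> amounts to prescribing \<open>e\<^sub>1, e\<^sub>2, p\<^sub>3\<close>.\<close>

lemma newton_3:
  fixes x :: "nat \<Rightarrow> 'b"
  shows "esym 3 n x = (\<Sum>i<n. x i ^ 3) + (\<Sum>i<n. x i) ^ 3 + (\<Sum>i<n. x i) * esym 2 n x"
  by (induction n)
     (simp_all add: esym_2_Suc esym_3_Suc power3_eq_cube algebra_simps zero_power)

lemma esym_pow2:
  fixes x :: "nat \<Rightarrow> 'b"
  shows "esym j n x ^ (2 ^ m) = esym j n (\<lambda>i. x i ^ (2 ^ m))"
proof (induction n arbitrary: j)
  case 0
  then show ?case by (cases j) (simp_all add: zero_power)
next
  case (Suc n)
  then show ?case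
    by (cases j) (simp_all add: esym_Suc_Suc pow2_add power_mult_distrib)
qed

lemma pow2_pow2: "(x ^ 2 ^ a) ^ 2 ^ b = (x::'b) ^ 2 ^ (a + b)"
  by (simp add: power_add power_mult)

lemma esym_conj_GF:
  fixes x :: 'b
  assumes "x \<in> GF (r * k)"
  shows "esym j k (\<lambda>i. x ^ (2 ^ (r * i))) \<in> GF r"
proof -
  have "esym j k (\<lambda>i. x ^ (2 ^ (r * i))) ^ (2 ^ r) = esym j k (\<lambda>i. x ^ (2 ^ (r * Suc i)))"
    by (simp add: esym_pow2 pow2_pow2 add.commute)
  also have "\<dots> = esym j k (\<lambda>i. x ^ (2 ^ (r * i)))"
    by (rule esym_cyclic) (use assms in \<open>simp add: GF_def\<close>)
  finally show ?thesis by (simp add: GF_def)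
qed

lemma esq_GF: "x \<in> GF (r * k) \<Longrightarrow> esq r k x \<in> GF r" for x :: 'b
  by (simp add: esq_def esym_conj_GF)

lemma rtrace_GF: "x \<in> GF (r * k) \<Longrightarrow> rtrace r k x \<in> GF r" for x :: 'b
  unfolding rtrace_def esym_1[symmetric] by (rule esym_conj_GF)

lemma rtrace_add: "rtrace r k (x + y) = rtrace r k x + rtrace r k (y::'b)"
  by (simp add: rtrace_def pow2_add sum.distrib)

lemma rtrace_plus: "rtrace r (k + l) x = rtrace r k x + rtrace r l (x ^ (2 ^ (r * k)))" for x :: 'b
  unfolding rtrace_def
  by (induction l) (simp_all add: pow2_pow2 distrib_left add.assoc)

lemma rtrace_square: "(rtrace r k x)\<^sup>2 = rtrace r k (x\<^sup>2)" for x :: 'b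
  unfolding rtrace_def using pow2_sum[of "\<lambda>i. x ^ 2 ^ (r * i)" "{..<k}" 1]
  by (simp add: mult.commute flip: power_mult)

lemma rtrace_scale: "c \<in> GF r \<Longrightarrow> rtrace r k (c * x) = c * rtrace r k x" for x c :: 'b
  by (simp add: rtrace_def power_mult_distrib sum_distrib_left GF_mult_power)

lemma trace2_rtrace: "trace2 r (rtrace r k x) = trace2 (r * k) x" for x :: 'b
proof (induction k)
  case (Suc k)
  have "rtrace r (Suc k) x = rtrace r k x + x ^ (2 ^ (r * k))"
    by (simp add: rtrace_def)
  then show ?case
    using Suc trace2_plus[of "r * k" r x] by (simp add: trace2_add add.commute)
qed (simp add: rtrace_def trace2_def zero_power)

lemma trace2_scale_rtrace: "c \<in> GF r \<Longrightarrow> trace2 r (c * rtrace r k x) = trace2 (r * k) (c * x)"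
  for x c :: 'b
  by (simp add: trace2_rtrace flip: rtrace_scale)

lemma esq_add: "esq r k (x + y) =
    esq r k x + esq r k y + rtrace r k x * rtrace r k y + rtrace r k (x * y)" for x y :: 'b
  by (simp add: esq_def rtrace_def pow2_add esym_2_add power_mult_distrib)

lemma esq_plus: "esq r (k + l) x =
    esq r k x + esq r l (x ^ (2 ^ (r * k))) + rtrace r k x * rtrace r l (x ^ (2 ^ (r * k)))"
  for x :: 'b
  by (simp add: esq_def rtrace_def esym_2_plus pow2_pow2 distrib_left)

end

section \<open>The quadratic exponent on a quadratic extension\<close>

text \<open>An Artin--Schreier generator \<open>\<theta>\<close> of \<open>GF (r * 24)\<close> over \<open>W = GF (r * 12)\<close>, whose conjugate over \<open>W\<close>
  is \<open>\<theta> + 1\<close>; the constant term \<open>\<delta>\<close> of its minimal polynomial has absolute trace 1.\<close>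

locale char_two_quadratic = char_two ty for ty :: "'b::alg_closed_field itself" +
  fixes r :: nat and \<theta> \<delta> :: 'b
  assumes r_pos: "r > 0"
    and theta_conj: "\<theta> ^ (2 ^ (r * 12)) = \<theta> + 1"
    and delta_def: "\<delta> = \<theta>\<^sup>2 + \<theta>"
    and trace_delta: "trace2 (r * 12) \<delta> = 1"
begin

abbreviation "W \<equiv> (GF (r * 12) :: 'b set)"

lemma delta_W: "\<delta> \<in> W"
  using theta_conj by (simp add: GF_def delta_def pow2_add power_mult_distrib power2_eq_square algebra_simps)

lemma conj_decomp: "w \<in> W \<Longrightarrow> b \<in> W \<Longrightarrow> (w + b * \<theta>) ^ (2 ^ (r * 12)) = w + b * \<theta> + b"
  by (simp add: GF_def pow2_add power_mult_distrib theta_conj algebra_simps)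

lemma rtrace_decomp:
  assumes "w \<in> W" "b \<in> W"
  shows "rtrace r 24 (w + b * \<theta>) = rtrace r 12 b"
  using rtrace_plus[of r 12 12 "w + b * \<theta>"] conj_decomp[OF assms]
  by (simp add: rtrace_add)

lemma rtrace_cube_decomp:
  assumes "w \<in> W" "b \<in> W"
  shows "rtrace r 24 ((w + b * \<theta>) ^ 3) = rtrace r 12 (w\<^sup>2 * b + w * b\<^sup>2 + b ^ 3 * (\<delta> + 1))"
proof -
  have "((w + b * \<theta>) ^ 3) ^ (2 ^ (r * 12)) = (w + b * \<theta> + b) ^ 3"
    using conj_decomp[OF assms] by (metis mult.commute power_mult)
  then have "rtrace r 24 ((w + b * \<theta>) ^ 3) = rtrace r 12 ((w + b * \<theta>) ^ 3 + (w + b * \<theta> + b) ^ 3)"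
    using rtrace_plus[of r 12 12 "(w + b * \<theta>) ^ 3"] by (simp add: rtrace_add)
  also have "(w + b * \<theta>) ^ 3 + (w + b * \<theta> + b) ^ 3 = w\<^sup>2 * b + w * b\<^sup>2 + b ^ 3 * (\<delta> + 1)"
    by (simp add: power3_eq_cube power2_eq_square delta_def algebra_simps)
  finally show ?thesis .
qed

lemma esq_decomp:
  assumes "w \<in> W" "b \<in> W"
  shows "esq r 24 (w + b * \<theta>) =
    (rtrace r 12 w)\<^sup>2 + rtrace r 12 (w * b) + rtrace r 12 (b\<^sup>2 * \<delta>) + esq r 12 b"
proof -
  define a where "a = w + b * \<theta>"
  have "esq r 24 a = esq r 12 b + rtrace r 12 (a * b) + (rtrace r 12 a)\<^sup>2"
    using esq_plus[of r 12 12 a] conj_decomp[OF assms, folded a_def]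
    by (simp add: esq_add rtrace_add power2_eq_square algebra_simps)
  also have "\<dots> = esq r 12 b + rtrace r 12 (a * b + w\<^sup>2 + (b * \<theta>)\<^sup>2)"
    by (simp add: a_def rtrace_square rtrace_add square_add add.assoc)
  also have "a * b + w\<^sup>2 + (b * \<theta>)\<^sup>2 = w\<^sup>2 + w * b + b\<^sup>2 * \<delta>"
    by (simp add: a_def delta_def power2_eq_square algebra_simps)
  finally show ?thesis by (simp add: a_def rtrace_add rtrace_square algebra_simps)
qed

text \<open>The part of the quadratic exponent at \<open>w + b * \<theta>\<close> that does not depend on \<open>w\<close>.\<close>

definition expo :: "'b \<Rightarrow> 'b \<Rightarrow> 'b \<Rightarrow> 'b \<Rightarrow> 'b" where
  "expo c1 c2 c3 b = trace2 r (c2 * esq r 12 b) +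
     trace2 (r * 12) (c1 * b + c2 * b\<^sup>2 * \<delta> + c3 * b ^ 3 * (\<delta> + 1))"

lemma W_of_F: "c \<in> GF r \<Longrightarrow> c \<in> W" for c
  by (rule GF_mono) auto

text \<open>The decisive computation: for fixed \<open>b\<close> the exponent is affine in \<open>w\<close> over the prime field.
  All linear terms are brought to the shape \<open>trace2 (D * w\<^sup>2)\<close> by the invariance of the trace
  under squaring, and the resulting coefficient \<open>D = e (1 + b\<^sup>2 e)\<close> factors.\<close>

lemma trace_decomp:
  assumes "w \<in> W" "b \<in> W" and c: "c1 \<in> GF r" "c2 \<in> GF r" "c3 \<in> GF r"
  defines "e \<equiv> c2 + c3 * b"
  shows "trace2 r (c1 * rtrace r 24 (w + b * \<theta>) + c2 * esq r 24 (w + b * \<theta>)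
            + c3 * rtrace r 24 ((w + b * \<theta>) ^ 3)) =
         trace2 (r * 12) (e * (1 + b\<^sup>2 * e) * w\<^sup>2) + expo c1 c2 c3 b"
proof -
  obtain d where d: "d \<in> GF r" "d\<^sup>2 = c2" using sqrt_GF r_pos c by blast
  note W = W_of_F[OF c(1)] W_of_F[OF c(2)] W_of_F[OF c(3)] W_of_F[OF d(1)]
  have sq: "trace2 r (c2 * (rtrace r 12 w)\<^sup>2) = trace2 (r * 12) (c2 * w\<^sup>2)"
  proof -
    have "trace2 r (c2 * (rtrace r 12 w)\<^sup>2) = trace2 r ((d * rtrace r 12 w)\<^sup>2)"
      by (simp add: power_mult_distrib d)
    also have "\<dots> = trace2 r (d * rtrace r 12 w)"
      by (intro trace2_square) (simp add: d rtrace_GF assms)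
    also have "\<dots> = trace2 (r * 12) (d * w)"
      by (rule trace2_scale_rtrace[OF d(1)])
    also have "\<dots> = trace2 (r * 12) ((d * w)\<^sup>2)"
      using trace2_square[of "d * w" "r * 12"] W assms by simp
    finally show ?thesis by (simp add: power_mult_distrib d)
  qed
  have lin: "trace2 (r * 12) (e * b * w) = trace2 (r * 12) (e\<^sup>2 * b\<^sup>2 * w\<^sup>2)"
    using trace2_square[of "e * b * w" "r * 12"] W assms by (simp add: power_mult_distrib)
  have "trace2 r (c1 * rtrace r 24 (w + b * \<theta>) + c2 * esq r 24 (w + b * \<theta>)
            + c3 * rtrace r 24 ((w + b * \<theta>) ^ 3)) =
     trace2 (r * 12) (c1 * b) + (trace2 (r * 12) (c2 * w\<^sup>2) + trace2 (r * 12) (c2 * (w * b)) +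
       trace2 (r * 12) (c2 * (b\<^sup>2 * \<delta>)) + trace2 r (c2 * esq r 12 b))
     + trace2 (r * 12) (c3 * (w\<^sup>2 * b + w * b\<^sup>2 + b ^ 3 * (\<delta> + 1)))"
    unfolding rtrace_decomp[OF assms(1,2)] esq_decomp[OF assms(1,2)]
      rtrace_cube_decomp[OF assms(1,2)]
    using c by (simp only: distrib_left trace2_add trace2_scale_rtrace sq)
  also have "\<dots> = trace2 (r * 12) (e * w\<^sup>2) + trace2 (r * 12) (e * b * w) + expo c1 c2 c3 b"
    unfolding e_def expo_def
    by (simp add: algebra_simps power2_eq_square power3_eq_cube flip: trace2_add)
  also have "\<dots> = trace2 (r * 12) (e * (1 + b\<^sup>2 * e) * w\<^sup>2) + expo c1 c2 c3 b"
    unfolding lin by (simp add: algebra_simps power2_eq_square flip: trace2_add)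
  finally show ?thesis .
qed

end

section \<open>The auxiliary cubic\<close>

context char_two
begin

lemma sum_chi_square:
  fixes D :: 'b
  assumes "n > 0" "D \<in> GF n"
  shows "(\<Sum>w\<in>GF n. chi n (D * w\<^sup>2)) = (if D = 0 then 2 ^ n else 0)"
proof -
  have inj: "inj_on (\<lambda>w::'b. w\<^sup>2) (GF n)"
    using pow2_inj[of _ 1] by (auto simp: inj_on_def)
  have im: "(\<lambda>w::'b. w\<^sup>2) ` GF n = GF n"
    by (rule endo_inj_surj) (use inj assms in \<open>auto simp: finite_GF\<close>)
  have "(\<Sum>w\<in>GF n. chi n (D * w\<^sup>2)) = (\<Sum>w\<in>(\<lambda>w::'b. w\<^sup>2) ` GF n. chi n (D * w))"
    by (simp add: sum.reindex[OF inj])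
  then show ?thesis by (simp only: im sum_chi[OF assms])
qed

lemma rtrace_twice: "x \<in> GF (r * k) \<Longrightarrow> rtrace r (k + k) x = 0" for x :: 'b
  by (simp add: rtrace_plus GF_def)

lemma card_cubic:
  fixes a c :: 'b
  assumes c: "c \<noteq> 0"
  shows "card {b. c * b ^ 3 + a * b\<^sup>2 = 1} = 3"
proof -
  define p where "p = [:1, 0, a, c:]"
  have poly_p: "poly p b = c * b ^ 3 + a * b\<^sup>2 + 1" for b
    by (simp add: p_def power2_eq_square power3_eq_cube algebra_simps)
  have three: "(3::'b) = 1"
  proof -
    have "(3::'b) = 2 + 1" by simp
    then show ?thesis by (simp only: two_eq_0 add_0)
  qed
  have pd: "poly (pderiv p) b = c * b\<^sup>2" for b
    by (simp add: p_def pderiv_pCons power2_eq_square algebra_simps two_eq_0 three)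
  have "card {b. poly p b = 0} = degree p"
  proof (rule card_roots_separable)
    show "poly (pderiv p) b \<noteq> 0" if "poly p b = 0" for b
      using that by (auto simp: pd c poly_p zero_power)
    show "p \<noteq> 0" by (simp add: p_def)
  qed
  then show ?thesis by (simp add: poly_p) (simp add: p_def c)
qed

lemma cubic_conj:
  fixes a c b :: 'b
  assumes "c \<in> GF r" "a \<in> GF r"
  shows "(c * b ^ 3 + a * b\<^sup>2) ^ (2 ^ r) = c * (b ^ (2 ^ r)) ^ 3 + a * (b ^ (2 ^ r))\<^sup>2"
proof -
  have swap: "(b ^ j) ^ (2 ^ r) = (b ^ (2 ^ r)) ^ j" for j
    by (simp add: mult.commute flip: power_mult)
  show ?thesis
    using assms unfolding pow2_add power_mult_distrib swap by (simp add: GF_def)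
qed

text \<open>Frobenius permutes the three roots of a separable cubic, so each of them has degree at most 3.\<close>

lemma cubic_root_period:
  fixes a c b :: 'b
  assumes c: "c \<noteq> 0" "c \<in> GF r" "a \<in> GF r" and b: "c * b ^ 3 + a * b\<^sup>2 = 1"
  shows "b \<in> GF (r * 2) \<or> b \<in> GF (r * 3)"
proof -
  define R where "R = {b. c * b ^ 3 + a * b\<^sup>2 = 1}"
  define f where "f = (\<lambda>b::'b. b ^ (2 ^ r))"
  have inj: "f x = f y \<longleftrightarrow> x = y" for x y by (simp add: f_def pow2_inj)
  have fR: "f x \<in> R" if "x \<in> R" for x
  proof -
    have "(c * x ^ 3 + a * x\<^sup>2) ^ (2 ^ r) = 1" using that by (simp add: R_def)
    moreover have "(c * x ^ 3 + a * x\<^sup>2) ^ (2 ^ r) = c * (f x) ^ 3 + a * (f x)\<^sup>2"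
      unfolding f_def by (rule cubic_conj[OF c(2,3)])
    ultimately show ?thesis by (simp add: R_def)
  qed
  have card: "card R = 3" unfolding R_def by (rule card_cubic[OF c(1)])
  have bR: "b \<in> R" using b by (simp add: R_def)
  have "f (f b) = b \<or> f (f (f b)) = b"
  proof (cases "b = f b \<or> b = f (f b)")
    case True
    then show ?thesis by metis
  next
    case False
    then have "card {b, f b, f (f b)} = 3" by (auto simp: inj)
    then have "{b, f b, f (f b)} = R"
      using card bR fR by (intro card_subset_eq) (auto intro: card_ge_0_finite)
    then have "f (f (f b)) \<in> {b, f b, f (f b)}" using fR bR by blast
    then show ?thesis using inj by auto
  qed
  moreover have "f (f x) = x ^ (2 ^ (r * 2))" "f (f (f x)) = x ^ (2 ^ (r * 3))" for x
  proof -
    have "r * 2 = r + r" "r * 3 = r + r + r" by simp_all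
    then show "f (f x) = x ^ (2 ^ (r * 2))" "f (f (f x)) = x ^ (2 ^ (r * 3))"
      by (simp_all only: f_def pow2_pow2)
  qed
  ultimately show ?thesis by (simp add: GF_def)
qed

text \<open>If the root has degree 2, its cubic splits as \<open>c (X + s) (X\<^sup>2 + t X + t s)\<close> with
  \<open>c t s\<^sup>2 = 1\<close>; then \<open>a t\<^sup>2 = z + z\<^sup>2\<close> for \<open>z = t / s\<close>, which has trace zero. In the other cases
  \<open>rtrace r 6 b\<close> itself vanishes.\<close>

lemma cubic_root_trace:
  fixes a c b :: 'b
  assumes c: "c \<noteq> 0" "c \<in> GF r" "a \<in> GF r" and b: "c * b ^ 3 + a * b\<^sup>2 = 1"
  shows "trace2 r (a * (rtrace r 6 b)\<^sup>2) = 0"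
  using cubic_root_period[OF assms]
proof
  assume "b \<in> GF (r * 3)"
  then show ?thesis using rtrace_twice[of b r 3] by simp
next
  assume b2: "b \<in> GF (r * 2)"
  define b' where "b' = b ^ (2 ^ r)"
  define t where "t = b + b'"
  have tr: "rtrace r 6 b = t"
  proof -
    have "rtrace r (2 + (2 + 2)) b = rtrace r 2 b"
      using b2 rtrace_twice[of b r 2] by (subst rtrace_plus) (simp add: GF_def)
    also have "rtrace r 2 b = t" by (simp add: rtrace_def numeral_2_eq_2 t_def b'_def)
    finally show ?thesis by simp
  qed
  show ?thesis
  proof (cases "t = 0")
    case True
    then show ?thesis by (simp add: tr)
  next
    case False
    have tF: "t \<in> GF r" unfolding tr[symmetric]
      by (rule rtrace_GF) (rule GF_mono[OF b2], auto)
    have b': "c * b' ^ 3 + a * b'\<^sup>2 = 1"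
    proof -
      have "(c * b ^ 3 + a * b\<^sup>2) ^ (2 ^ r) = c * b' ^ 3 + a * b'\<^sup>2"
        unfolding b'_def by (rule cubic_conj[OF c(2,3)])
      then show ?thesis by (simp add: b)
    qed
    \<comment> \<open>\<open>t\<close> and \<open>p\<close> are the sum and the product of two conjugate roots; \<open>s\<close> is the third root.\<close>
    define p where "p = b * b'"
    have bb': "b' = b + t" by (simp add: t_def)
    have "t * (c * (t\<^sup>2 + p) + a * t) = (c * b ^ 3 + a * b\<^sup>2) + (c * b' ^ 3 + a * b'\<^sup>2)"
      by (simp add: p_def bb' power2_eq_square power3_eq_cube algebra_simps)
    then have 1: "c * (t\<^sup>2 + p) = a * t" using b b' False by simp
    have "c * p * t + a * p = b * (c * (t\<^sup>2 + p) + a * t) + (c * b ^ 3 + a * b\<^sup>2)"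
      by (simp add: p_def bb' power2_eq_square power3_eq_cube algebra_simps)
    then have "c * p * t + a * p = 1" by (simp only: 1 b add_self mult_zero_right add_0)
    then have 2: "p * (c * t + a) = 1" by (simp add: algebra_simps)
    define s where "s = a / c + t"
    have cs: "c * s = c * t + a" using c by (simp add: s_def field_simps)
    have "c * (t * s) = t * (c * s)" by (simp add: ac_simps)
    also have "\<dots> = c * t\<^sup>2 + a * t" by (simp add: cs power2_eq_square algebra_simps)
    also have "\<dots> = c * p" by (simp add: 1[symmetric] distrib_left)
    finally have p: "p = t * s" using c by simp
    have "c * t * s\<^sup>2 = p * (c * s)" by (simp add: p power2_eq_square ac_simps)
    then have 3: "c * t * s\<^sup>2 = 1" using 2 by (simp only: cs)
    then have s0: "s \<noteq> 0" by auto
    define z where "z = t / s"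
    have zF: "z \<in> GF r" using tF c by (simp add: z_def s_def)
    have a: "a = c * (s + t)" using c by (simp add: s_def field_simps)
    have "a * t\<^sup>2 * s\<^sup>2 = (c * t * s\<^sup>2) * (t * (s + t))"
      by (simp add: a power2_eq_square ac_simps)
    also have "\<dots> = t * s + t\<^sup>2" unfolding 3 by (simp add: power2_eq_square distrib_left)
    also have "\<dots> = (z + z\<^sup>2) * s\<^sup>2"
      using s0 by (simp add: z_def field_simps power2_eq_square)
    finally have "a * t\<^sup>2 = z + z\<^sup>2" using s0 by simp
    then show ?thesis using zF by (simp add: tr trace2_add trace2_square)
  qed
qed

end

section \<open>Evaluation of the exponential sums\<close>

context char_two_quadratic
begin

text \<open>Every \<open>\<alpha>\<close> in \<open>GF (r * 24)\<close> is uniquely \<open>w + b * \<theta>\<close> with \<open>w, b \<in> W\<close>; here \<open>b\<close> is the relative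
  trace of \<open>\<alpha>\<close>.\<close>

lemma sum_decomp:
  "(\<Sum>\<alpha>\<in>GF (r * 24). f \<alpha>) = (\<Sum>b\<in>W. \<Sum>w\<in>W. f (w + b * \<theta>))"
proof -
  let ?Q = "2 ^ (r * 12) :: nat"
  have dec: "\<alpha> + (\<alpha> + \<alpha> ^ ?Q) * \<theta> \<in> W" "\<alpha> + \<alpha> ^ ?Q \<in> W" if "\<alpha> \<in> GF (r * 24)" for \<alpha> :: 'b
  proof -
    have "(\<alpha> ^ ?Q) ^ ?Q = \<alpha>" using that by (simp add: GF_def pow2_pow2 flip: mult_2)
      (simp add: mult.commute)
    then show "\<alpha> + (\<alpha> + \<alpha> ^ ?Q) * \<theta> \<in> W" "\<alpha> + \<alpha> ^ ?Q \<in> W"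
      by (simp_all add: GF_def pow2_add power_mult_distrib theta_conj algebra_simps)
  qed
  have cmp: "w + b * \<theta> \<in> GF (r * 24)" if "b \<in> W" "w \<in> W" for b w
  proof -
    have "r * 24 = r * 12 + r * 12" by simp
    then have "(w + b * \<theta>) ^ (2 ^ (r * 24)) = ((w + b * \<theta>) ^ ?Q) ^ ?Q"
      by (simp only: pow2_pow2)
    also have "\<dots> = w + b * \<theta>"
    proof -
      have "b ^ ?Q = b" using that by (simp add: GF_def)
      then show ?thesis
        by (simp only: conj_decomp[OF that(2,1)] pow2_add[of "w + b * \<theta>" b]) (simp add: add.assoc)
    qed
    finally show ?thesis by (simp add: GF_def)
  qed
  have "(\<Sum>\<alpha>\<in>GF (r * 24). f \<alpha>) = (\<Sum>(b, w)\<in>W \<times> W. f (w + b * \<theta>))"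
    by (rule sum.reindex_bij_witness[of _ "\<lambda>(b, w). w + b * \<theta>"
            "\<lambda>\<alpha>. (\<alpha> + \<alpha> ^ ?Q, \<alpha> + (\<alpha> + \<alpha> ^ ?Q) * \<theta>)"])
       (auto simp: dec cmp conj_decomp add.assoc two_eq_0)
  then show ?thesis by (simp add: sum.cartesian_product)
qed

lemma expo_cases:
  assumes "b \<in> W" and c: "c1 \<in> GF r" "c2 \<in> GF r" "c3 \<in> GF r"
  shows "expo c1 c2 c3 b = 0 \<or> expo c1 c2 c3 b = 1"
proof -
  have "trace2 r (c2 * esq r 12 b) = 0 \<or> trace2 r (c2 * esq r 12 b) = 1"
    by (rule trace2_cases) (simp add: c esq_GF assms)
  moreover have "trace2 (r * 12) (c1 * b + c2 * b\<^sup>2 * \<delta> + c3 * b ^ 3 * (\<delta> + 1)) = 0 \<or>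
      trace2 (r * 12) (c1 * b + c2 * b\<^sup>2 * \<delta> + c3 * b ^ 3 * (\<delta> + 1)) = 1"
    by (rule trace2_cases) (simp add: c W_of_F assms delta_W)
  ultimately show ?thesis by (auto simp: expo_def)
qed

text \<open>The exponential sum of the quadratic function attached to the frequencies \<open>c1, c2, c3\<close>, over
  the field with \<open>q\<^sup>2\<^sup>4\<close> elements, where \<open>q = 2\<^sup>r\<close>.\<close>

definition char_sum :: "'b \<Rightarrow> 'b \<Rightarrow> 'b \<Rightarrow> int" where
  "char_sum c1 c2 c3 = (\<Sum>\<alpha>\<in>GF (r * 24).
     chi r (c1 * rtrace r 24 \<alpha> + c2 * esq r 24 \<alpha> + c3 * rtrace r 24 (\<alpha> ^ 3)))"

text \<open>Summing over \<open>w\<close> first kills every \<open>b\<close> with \<open>D \<noteq> 0\<close>.\<close>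

lemma char_sum_reduce:
  assumes c: "c1 \<in> GF r" "c2 \<in> GF r" "c3 \<in> GF r"
  shows "char_sum c1 c2 c3 = 2 ^ (r * 12) *
    (\<Sum>b | b \<in> W \<and> (c2 + c3 * b = 0 \<or> b\<^sup>2 * (c2 + c3 * b) = 1). bit_sign (expo c1 c2 c3 b))"
proof -
  define D where "D = (\<lambda>b. (c2 + c3 * b) * (1 + b\<^sup>2 * (c2 + c3 * b)))"
  have fold_D: "(c2 + c3 * b) * (1 + b\<^sup>2 * (c2 + c3 * b)) = D b" for b
    by (simp add: D_def)
  have D0: "D b = 0 \<longleftrightarrow> c2 + c3 * b = 0 \<or> b\<^sup>2 * (c2 + c3 * b) = 1" for b
    unfolding D_def by (metis add_eq_0_char2 mult_eq_0_iff)
  have DW: "D b \<in> W" if "b \<in> W" for b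
    using that c by (simp add: D_def W_of_F)
  have "char_sum c1 c2 c3 =
      (\<Sum>b\<in>W. \<Sum>w\<in>W. chi (r * 12) (D b * w\<^sup>2) * bit_sign (expo c1 c2 c3 b))"
    unfolding char_sum_def sum_decomp
  proof (intro sum.cong refl)
    fix b w assume bw: "b \<in> W" "w \<in> W"
    show "chi r (c1 * rtrace r 24 (w + b * \<theta>) + c2 * esq r 24 (w + b * \<theta>)
            + c3 * rtrace r 24 ((w + b * \<theta>) ^ 3)) =
          chi (r * 12) (D b * w\<^sup>2) * bit_sign (expo c1 c2 c3 b)"
      unfolding chi_def trace_decomp[OF bw(2,1) c] fold_D
      using bw by (intro bit_sign_add trace2_cases expo_cases c) (simp_all add: DW)
  qed
  also have "\<dots> = (\<Sum>b\<in>W. if D b = 0 then 2 ^ (r * 12) * bit_sign (expo c1 c2 c3 b) else 0)"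
    by (intro sum.cong refl) (use r_pos in \<open>simp add: sum_chi_square DW flip: sum_distrib_right\<close>)
  also have "\<dots> = (\<Sum>b | b \<in> W \<and> D b = 0. 2 ^ (r * 12) * bit_sign (expo c1 c2 c3 b))"
    using r_pos by (simp add: sum.inter_filter finite_GF)
  finally show ?thesis by (simp only: D0 sum_distrib_left)
qed

text \<open>For \<open>b\<close> in \<open>GF (r * 6)\<close>, over which \<open>W\<close> has degree 2, the traces of \<open>c1 * b\<close> and \<open>c3 * b ^ 3\<close>
  vanish, and \<open>esq r 12 b\<close> is the square of \<open>rtrace r 6 b\<close>; only the term containing \<open>\<delta>\<close> survives.\<close>

lemma expo_eval:
  assumes b: "b \<in> GF (r * 6)" and c: "c1 \<in> GF r" "c2 \<in> GF r" "c3 \<in> GF r"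
    and tr: "trace2 r (c2 * (rtrace r 6 b)\<^sup>2) = 0"
  shows "expo c1 c2 c3 b = trace2 (r * 12) (b\<^sup>2 * (c2 + c3 * b) * \<delta>)"
proof -
  have c6: "c \<in> GF (r * 6)" if "c \<in> GF r" for c :: 'b
    by (rule GF_mono[OF that]) simp
  have "esq r (6 + 6) b = (rtrace r 6 b)\<^sup>2"
    using b unfolding esq_plus by (simp add: GF_def power2_eq_square)
  moreover have "c1 * b + c2 * b\<^sup>2 * \<delta> + c3 * b ^ 3 * (\<delta> + 1) =
      (c1 * b + c3 * b ^ 3) + b\<^sup>2 * (c2 + c3 * b) * \<delta>"
    by (simp add: power2_eq_square power3_eq_cube algebra_simps)
  moreover have "trace2 (r * 12) (c1 * b + c3 * b ^ 3) = 0"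
    using trace2_double[of "c1 * b + c3 * b ^ 3" "r * 6"] b c6 c by (simp add: ac_simps)
  ultimately show ?thesis using tr unfolding expo_def
    by (simp only: trace2_add[of _ "c1 * b + c3 * b ^ 3"]) simp
qed

text \<open>If \<open>c3 \<noteq> 0\<close>, the surviving \<open>b\<close> are \<open>c2 / c3\<close>, contributing \<open>1\<close>, and the three roots of
  \<open>c3 X\<^sup>3 + c2 X\<^sup>2 + 1\<close>, contributing \<open>-1\<close> each. If \<open>c3 = 0 \<noteq> c2\<close>, only \<open>b = c2\<^sup>-\<^sup>1\<^sup>/\<^sup>2\<close> survives,
  contributing \<open>-1\<close>. If \<open>c2 = c3 = 0\<close>, the whole sum is a linear character sum.\<close>

lemma char_sum_eval:
  assumes c: "c1 \<in> GF r" "c2 \<in> GF r" "c3 \<in> GF r"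
  shows "char_sum c1 c2 c3 =
    2 ^ (r * 24) * of_bool (c1 = 0 \<and> c2 = 0 \<and> c3 = 0) - 2 * 2 ^ (r * 12)
    + 2 ^ (r * 12) * of_bool (c3 = 0) + 2 ^ (r * 12) * of_bool (c2 = 0 \<and> c3 = 0)"
proof -
  let ?B = "\<Sum>b | b \<in> W \<and> (c2 + c3 * b = 0 \<or> b\<^sup>2 * (c2 + c3 * b) = 1). bit_sign (expo c1 c2 c3 b)"
  have F6: "rtrace r 6 b = 0" if "b \<in> GF r" for b :: 'b
    using rtrace_twice[OF GF_mono[OF that], of r 3] by simp
  have mono6: "b \<in> GF (r * 6)" if "b \<in> GF (r * k)" "k dvd 6" for b :: 'b and k
    by (rule GF_mono[OF that(1)]) (use that in auto)
  have W6: "b \<in> W" if "b \<in> GF (r * 6)" for b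
    by (rule GF_mono[OF that]) auto
  show ?thesis
  proof (cases "c3 = 0")
    case c3: False
    define b0 where "b0 = c2 / c3"
    define R where "R = {b. c3 * b ^ 3 + c2 * b\<^sup>2 = 1}"
    have b0F: "b0 \<in> GF r" using c by (simp add: b0_def)
    have e0: "c2 + c3 * b = 0 \<longleftrightarrow> b = b0" for b
      using c3 by (auto simp: b0_def field_simps)
    have R: "b\<^sup>2 * (c2 + c3 * b) = 1 \<longleftrightarrow> b \<in> R" for b
      by (simp add: R_def power2_eq_square power3_eq_cube algebra_simps)
    have R6: "b \<in> GF (r * 6)" if "b \<in> R" for b
      using that cubic_root_period[OF c3 c(3,2), of b] mono6[of b 2] mono6[of b 3] by (auto simp: R_def)
    have b0R: "b0 \<notin> R" using e0[of b0] R[of b0] by auto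
    have cardR: "card R = 3" unfolding R_def by (rule card_cubic[OF c3])
    then have finR: "finite R" by (intro card_ge_0_finite) simp
    have "{b. b \<in> W \<and> (c2 + c3 * b = 0 \<or> b\<^sup>2 * (c2 + c3 * b) = 1)} = insert b0 R"
      unfolding e0 R using W6 R6 W_of_F[OF b0F] by auto
    then have "?B = bit_sign (expo c1 c2 c3 b0) + (\<Sum>b\<in>R. bit_sign (expo c1 c2 c3 b))"
      using finR b0R by simp
    also have "bit_sign (expo c1 c2 c3 b0) = 1"
      using e0[of b0] b0F mono6[of b0 1] by (simp add: expo_eval c F6 bit_sign_def)
    also have "(\<Sum>b\<in>R. bit_sign (expo c1 c2 c3 b)) = (\<Sum>b\<in>R. -1)"
    proof (intro sum.cong refl)
      fix b assume b: "b \<in> R"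
      have "expo c1 c2 c3 b = trace2 (r * 12) (b\<^sup>2 * (c2 + c3 * b) * \<delta>)"
        by (rule expo_eval[OF R6[OF b] c cubic_root_trace[OF c3 c(3,2)]]) (use b in \<open>simp add: R_def\<close>)
      then show "bit_sign (expo c1 c2 c3 b) = -1"
        using R[of b] b trace_delta by (simp add: bit_sign_def)
    qed
    finally show ?thesis using c3 cardR by (simp add: char_sum_reduce[OF c])
  next
    case c3: True
    show ?thesis
    proof (cases "c2 = 0")
      case c2: False
      obtain b0 where b0: "b0 \<in> GF r" "b0\<^sup>2 = 1 / c2"
        using sqrt_GF[of r "1 / c2"] r_pos c by auto
      have "b\<^sup>2 * c2 = 1 \<longleftrightarrow> b = b0" for b
      proof -
        have "b\<^sup>2 * c2 = 1 \<longleftrightarrow> b\<^sup>2 = b0\<^sup>2" unfolding b0(2) using c2 by (simp add: eq_divide_eq)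
        then show ?thesis using pow2_inj[of b 1 b0] by simp
      qed
      then have "{b. b \<in> W \<and> (c2 + c3 * b = 0 \<or> b\<^sup>2 * (c2 + c3 * b) = 1)} = {b0}"
        using W_of_F[OF b0(1)] c2 by (auto simp: c3)
      moreover have "expo c1 c2 c3 b0 = 1"
        using b0 c2 mono6[of b0 1] trace_delta by (simp add: expo_eval c F6 c3)
      ultimately show ?thesis unfolding char_sum_reduce[OF c] using c2 c3 by (simp add: bit_sign_def)
    next
      case c2: True
      have "?B = (\<Sum>b\<in>W. chi (r * 12) (c1 * b))"
        by (intro sum.cong) (auto simp: c2 c3 expo_def chi_def)
      also have "\<dots> = (if c1 = 0 then 2 ^ (r * 12) else 0)"
        using r_pos W_of_F[OF c(1)] by (intro sum_chi) auto
      finally show ?thesis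
        unfolding char_sum_reduce[OF c] by (simp add: c2 c3 flip: power_add mult_2)
    qed
  qed
qed

end

section \<open>Counting by Fourier inversion\<close>

lemma sum_triple_product:
  fixes f g h :: "_ \<Rightarrow> 'r::comm_semiring_0"
  shows "(\<Sum>a\<in>A. \<Sum>b\<in>B. \<Sum>c\<in>C. f a * g b * h c) = (\<Sum>a\<in>A. f a) * (\<Sum>b\<in>B. g b) * (\<Sum>c\<in>C. h c)"
  by (simp add: sum_distrib_left[symmetric] sum_distrib_right[symmetric])

context char_two_quadratic
begin

lemma indicator_chi:
  fixes x t :: 'b
  assumes "x \<in> GF r" "t \<in> GF r"
  shows "2 ^ r * of_bool (x = t) = (\<Sum>c\<in>GF r. chi r (c * x) * chi r (c * t))"
proof -
  have "(\<Sum>c\<in>GF r. chi r (c * x) * chi r (c * t)) = (\<Sum>c\<in>GF r. chi r ((x + t) * c))"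
    using assms by (intro sum.cong) (simp_all add: distrib_left chi_add mult.commute)
  also have "\<dots> = (if x + t = 0 then 2 ^ r else 0)"
    using assms r_pos by (intro sum_chi) auto
  finally show ?thesis by simp
qed

lemma fourier_count:
  assumes t: "t1 \<in> GF r" "t2 \<in> GF r" "t3 \<in> GF r"
  shows "(2 ^ r) ^ 3 * int (card {\<alpha> \<in> GF (r * 24).
      rtrace r 24 \<alpha> = t1 \<and> esq r 24 \<alpha> = t2 \<and> rtrace r 24 (\<alpha> ^ 3) = t3}) =
    (\<Sum>c1\<in>GF r. \<Sum>c2\<in>GF r. \<Sum>c3\<in>GF r.
       chi r (c1 * t1) * chi r (c2 * t2) * chi r (c3 * t3) * char_sum c1 c2 c3)"
proof -
  let ?K = "GF (r * 24) :: 'b set"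
  let ?p = "\<lambda>\<alpha>. rtrace r 24 \<alpha>" and ?e = "\<lambda>\<alpha>. esq r 24 \<alpha>" and ?s = "\<lambda>\<alpha>. rtrace r 24 (\<alpha> ^ 3)"
  have mem: "?p \<alpha> \<in> GF r" "?e \<alpha> \<in> GF r" "?s \<alpha> \<in> GF r" if "\<alpha> \<in> ?K" for \<alpha>
    using that by (simp_all add: rtrace_GF esq_GF)
  have fin: "finite ?K" using r_pos by (simp add: finite_GF)
  have "(2 ^ r) ^ 3 * int (card {\<alpha> \<in> ?K. ?p \<alpha> = t1 \<and> ?e \<alpha> = t2 \<and> ?s \<alpha> = t3}) =
    (\<Sum>\<alpha>\<in>?K. (2 ^ r) ^ 3 * of_bool (?p \<alpha> = t1 \<and> ?e \<alpha> = t2 \<and> ?s \<alpha> = t3))"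
    using fin by (simp add: of_bool_def sum.If_cases Int_def flip: sum_distrib_left)
  also have "\<dots> = (\<Sum>\<alpha>\<in>?K. (2 ^ r * of_bool (?p \<alpha> = t1)) * (2 ^ r * of_bool (?e \<alpha> = t2))
                          * (2 ^ r * of_bool (?s \<alpha> = t3)))"
    by (intro sum.cong) (auto simp: power3_eq_cube)
  also have "\<dots> = (\<Sum>\<alpha>\<in>?K. \<Sum>c1\<in>GF r. \<Sum>c2\<in>GF r. \<Sum>c3\<in>GF r.
      (chi r (c1 * ?p \<alpha>) * chi r (c1 * t1)) * (chi r (c2 * ?e \<alpha>) * chi r (c2 * t2)) *
      (chi r (c3 * ?s \<alpha>) * chi r (c3 * t3)))"
    by (intro sum.cong refl) (simp only: indicator_chi mem t sum_triple_product)
  also have "\<dots> = (\<Sum>\<alpha>\<in>?K. \<Sum>c1\<in>GF r. \<Sum>c2\<in>GF r. \<Sum>c3\<in>GF r.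
      chi r (c1 * t1) * chi r (c2 * t2) * chi r (c3 * t3) *
      chi r (c1 * ?p \<alpha> + c2 * ?e \<alpha> + c3 * ?s \<alpha>))"
    by (intro sum.cong refl) (simp add: chi_add mem)
  also have "\<dots> = (\<Sum>c1\<in>GF r. \<Sum>c2\<in>GF r. \<Sum>c3\<in>GF r. \<Sum>\<alpha>\<in>?K.
      chi r (c1 * t1) * chi r (c2 * t2) * chi r (c3 * t3) *
      chi r (c1 * ?p \<alpha> + c2 * ?e \<alpha> + c3 * ?s \<alpha>))"
    by (simp only: sum.swap[of _ _ ?K])
  finally show ?thesis by (simp only: char_sum_def sum_distrib_left)
qed

lemma power_sum_count:
  fixes t1 t2 t3 :: 'b
  assumes t: "t1 \<in> GF r" "t2 \<in> GF r" "t3 \<in> GF r"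
  defines "q \<equiv> 2 ^ r :: int"
  shows "int (card {\<alpha> \<in> GF (r * 24).
      rtrace r 24 \<alpha> = t1 \<and> esq r 24 \<alpha> = t2 \<and> rtrace r 24 (\<alpha> ^ 3) = t3}) =
    q ^ 21 - q ^ 10 * (2 * q\<^sup>2 * of_bool (t1 = 0 \<and> t2 = 0 \<and> t3 = 0)
      - q * of_bool (t1 = 0 \<and> t2 = 0) - of_bool (t1 = 0))"
    (is "?N = ?R")
proof -
  let ?f = "\<lambda>(t::'b) c. chi r (c * t)" and ?d = "\<lambda>c::'b. of_bool (c = 0) :: int"
  have q: "(2::int) ^ (r * k) = q ^ k" for k
    by (simp add: q_def power_mult)
  have f: "(\<Sum>c\<in>GF r. ?f t c) = q * ?d t" if "t \<in> GF r" for t :: 'b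
    using sum_chi[OF r_pos that] by (simp add: q_def mult.commute)
  have d: "(\<Sum>c\<in>GF r. ?f t c * ?d c) = 1" for t :: 'b
  proof -
    have "(\<Sum>c\<in>GF r. ?f t c * ?d c) = (\<Sum>c\<in>{0}. ?f t c * ?d c)"
      using r_pos by (intro sum.mono_neutral_right) (auto simp: finite_GF)
    then show ?thesis by simp
  qed
  have "q ^ 3 * ?N = (\<Sum>c1\<in>GF r. \<Sum>c2\<in>GF r. \<Sum>c3\<in>GF r.
       ?f t1 c1 * ?f t2 c2 * ?f t3 c3 * char_sum c1 c2 c3)"
    unfolding q_def by (rule fourier_count[OF t])
  also have "\<dots> = (\<Sum>c1\<in>GF r. \<Sum>c2\<in>GF r. \<Sum>c3\<in>GF r.
       q ^ 24 * ((?f t1 c1 * ?d c1) * (?f t2 c2 * ?d c2) * (?f t3 c3 * ?d c3))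
       + (- 2 * q ^ 12) * (?f t1 c1 * ?f t2 c2 * ?f t3 c3)
       + q ^ 12 * (?f t1 c1 * ?f t2 c2 * (?f t3 c3 * ?d c3))
       + q ^ 12 * (?f t1 c1 * (?f t2 c2 * ?d c2) * (?f t3 c3 * ?d c3)))"
    by (intro sum.cong refl) (simp add: char_sum_eval q of_bool_conj algebra_simps)
  also have "\<dots> =
      q ^ 24 * (\<Sum>c1\<in>GF r. \<Sum>c2\<in>GF r. \<Sum>c3\<in>GF r.
        (?f t1 c1 * ?d c1) * (?f t2 c2 * ?d c2) * (?f t3 c3 * ?d c3))
      + (- 2 * q ^ 12) * (\<Sum>c1\<in>GF r. \<Sum>c2\<in>GF r. \<Sum>c3\<in>GF r. ?f t1 c1 * ?f t2 c2 * ?f t3 c3)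
      + q ^ 12 * (\<Sum>c1\<in>GF r. \<Sum>c2\<in>GF r. \<Sum>c3\<in>GF r. ?f t1 c1 * ?f t2 c2 * (?f t3 c3 * ?d c3))
      + q ^ 12 * (\<Sum>c1\<in>GF r. \<Sum>c2\<in>GF r. \<Sum>c3\<in>GF r.
        ?f t1 c1 * (?f t2 c2 * ?d c2) * (?f t3 c3 * ?d c3))"
    by (simp only: sum.distrib sum_distrib_left)
  also have "\<dots> = q ^ 24 + (- 2 * q ^ 12) * ((q * ?d t1) * (q * ?d t2) * (q * ?d t3))
      + q ^ 12 * ((q * ?d t1) * (q * ?d t2)) + q ^ 12 * (q * ?d t1)"
    by (simp only: sum_triple_product f[OF t(1)] f[OF t(2)] f[OF t(3)] d mult_1_right)
  also have "\<dots> = q ^ 3 * ?R"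
    by (simp add: of_bool_conj) (simp add: algebra_simps eval_nat_numeral)
  finally show ?thesis by (simp add: q_def)
qed

end

context char_two
begin

text \<open>The element \<open>\<delta>\<close> is taken in \<open>GF (r * 4)\<close> with trace 1; as \<open>12 = 3 * 4\<close>, its trace from
  \<open>GF (r * 12)\<close> is still 1.\<close>

lemma exists_quadratic:
  assumes r: "r > 0"
  shows "\<exists>\<theta> \<delta> :: 'b. char_two_quadratic r \<theta> \<delta>"
proof -
  obtain \<delta> :: 'b where \<delta>: "\<delta> \<in> GF (r * 4)" "trace2 (r * 4) \<delta> = 1"
    using exists_trace2_1[of "r * 4"] r by auto
  have "degree [:\<delta>, 1, 1:] > 0" by simp
  then obtain \<theta> where "poly [:\<delta>, 1, 1:] \<theta> = 0"
    using alg_closed_imp_poly_has_root by blast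
  then have th: "\<delta> = \<theta>\<^sup>2 + \<theta>" by (simp add: power2_eq_square algebra_simps)
  have tr: "trace2 (r * 12) \<delta> = 1"
    using trace2_triple[OF \<delta>(1)] \<delta>(2) by (simp add: mult.commute mult.left_commute)
  have "trace2 (r * 12) \<delta> + \<theta> = (trace2 (r * 12) (\<theta>\<^sup>2) + \<theta>) + trace2 (r * 12) \<theta>"
    by (simp add: th trace2_add ac_simps)
  also have "\<dots> = \<theta> ^ (2 ^ (r * 12))"
    unfolding trace2_shift by (simp add: ac_simps)
  finally have "trace2 (r * 12) \<delta> + \<theta> = \<theta> ^ (2 ^ (r * 12))" .
  then have "\<theta> ^ (2 ^ (r * 12)) = \<theta> + 1" by (simp add: tr add.commute)
  then show ?thesis using tr th r by (intro exI[of _ \<theta>] exI[of _ \<delta>]) unfold_locales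
qed

lemma esym_count:
  fixes t1 t2 t3 :: 'b
  assumes r: "r > 0" and t: "t1 \<in> GF r" "t2 \<in> GF r" "t3 \<in> GF r"
  defines "q \<equiv> 2 ^ r :: int" and "e \<equiv> \<lambda>j \<alpha>. esym j 24 (\<lambda>i. \<alpha> ^ (2 ^ (r * i)))"
  shows "int (card {\<alpha> \<in> GF (r * 24). e 1 \<alpha> = t1 \<and> e 2 \<alpha> = t2 \<and> e 3 \<alpha> = t3}) =
    q ^ 21 - q ^ 10 * (2 * q\<^sup>2 * of_bool (t1 = 0 \<and> t2 = 0 \<and> t3 = 0)
      - q * of_bool (t1 = 0 \<and> t2 = 0) - of_bool (t1 = 0))"
proof -
  obtain \<theta> \<delta> :: 'b where "char_two_quadratic r \<theta> \<delta>" using exists_quadratic[OF r] by blast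
  then interpret char_two_quadratic "TYPE('b)" r \<theta> \<delta> .
  \<comment> \<open>\<open>u\<close> is the third power sum determined by \<open>t1, t2, t3\<close>; it equals \<open>t3\<close> when \<open>t1 = 0\<close>.\<close>
  define u where "u = t3 + t1 ^ 3 + t1 * t2"
  have e1: "e 1 \<alpha> = rtrace r 24 \<alpha>" for \<alpha> by (simp only: e_def esym_1 rtrace_def)
  have e2: "e 2 \<alpha> = esq r 24 \<alpha>" for \<alpha> by (simp only: e_def esq_def)
  have e3: "e 3 \<alpha> = rtrace r 24 (\<alpha> ^ 3) + (rtrace r 24 \<alpha>) ^ 3 + rtrace r 24 \<alpha> * esq r 24 \<alpha>" for \<alpha>
    unfolding e_def newton_3 esq_def rtrace_def by (simp add: mult.commute flip: power_mult)
  have "{\<alpha> \<in> GF (r * 24). e 1 \<alpha> = t1 \<and> e 2 \<alpha> = t2 \<and> e 3 \<alpha> = t3} =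
    {\<alpha> \<in> GF (r * 24). rtrace r 24 \<alpha> = t1 \<and> esq r 24 \<alpha> = t2 \<and> rtrace r 24 (\<alpha> ^ 3) = u}"
    unfolding e1 e2 e3 u_def by (auto simp: add.assoc add.commute add.left_commute)
  moreover have "u \<in> GF r" using t by (simp add: u_def)
  moreover have "(t1 = 0 \<and> t2 = 0 \<and> u = 0) \<longleftrightarrow> (t1 = 0 \<and> t2 = 0 \<and> t3 = 0)"
    by (auto simp: u_def)
  ultimately show ?thesis using power_sum_count[of t1 t2 u] t by (simp only: q_def)
qed

end

section \<open>The von Mangoldt function and characteristic polynomials\<close>

text \<open>The base field is a finite field with \<open>q = 2\<^sup>r\<close> elements. Its algebraic closure contains the
  base field as \<open>GF r\<close> and its extension of degree \<open>n > 0\<close> as \<open>GF (r * n)\<close>.\<close>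

locale finite_field_two =
  fixes ty :: "'a::{field,finite} itself" and r :: nat
  assumes card_base: "CARD('a) = 2 ^ r" and r_pos: "r > 0"
begin

lemma two_base: "(2::'a) = 0"
proof -
  have "(\<Sum>x\<in>UNIV. x + 1) = (\<Sum>x\<in>UNIV. x::'a)"
    by (rule sum.reindex_bij_witness[of _ "\<lambda>x. x - 1" "\<lambda>x. x + 1"]) auto
  then have "of_nat CARD('a) = (0::'a)" by (simp add: sum.distrib)
  then show ?thesis by (simp add: card_base)
qed

lemma power_card: "x ^ (2 ^ r) = (x::'a)"
proof (cases "x = 0")
  case False
  let ?U = "UNIV - {0::'a}"
  have "(\<Prod>y\<in>?U. x * y) = (\<Prod>y\<in>?U. y)"
    by (rule prod.reindex_bij_witness[of _ "\<lambda>y. y / x" "\<lambda>y. x * y"]) (use False in auto)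
  then have "x ^ card ?U * (\<Prod>y\<in>?U. y) = 1 * (\<Prod>y\<in>?U. y)"
    by (simp add: prod.distrib)
  moreover have "(\<Prod>y\<in>?U. y) \<noteq> 0" by simp
  ultimately have "x ^ card ?U = 1" by (metis mult_right_cancel)
  moreover have "card ?U = 2 ^ r - 1" by (simp add: card_base card_Diff_singleton)
  ultimately have "x ^ (2 ^ r - 1) * x = x" by simp
  then show ?thesis by (metis power_minus_mult zero_less_numeral zero_less_power)
qed (simp add: zero_power)

sublocale char_two "TYPE('a alg_closure)"
proof
  have "to_ac (2::'a) = 2" by simp
  then show "(2::'a alg_closure) = 0" by (simp only: two_base to_ac_0)
qed

lemma range_to_ac: "range (to_ac :: 'a \<Rightarrow> _) = GF r"
proof (rule card_subset_eq)
  show "finite (GF r :: 'a alg_closure set)" using r_pos by (rule finite_GF)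
  show "range (to_ac :: 'a \<Rightarrow> _) \<subseteq> GF r"
    by (auto simp: GF_def power_card simp flip: to_ac_power)
  show "card (range (to_ac :: 'a \<Rightarrow> _)) = card (GF r :: 'a alg_closure set)"
    using r_pos by (simp add: card_image inj_to_ac card_GF card_base)
qed

abbreviation lift :: "'a poly \<Rightarrow> 'a alg_closure poly" where
  "lift \<equiv> map_poly to_ac"

lemma lift_mult: "lift (p * q) = lift p * lift q"
  by (rule poly_eqI) (simp add: coeff_map_poly coeff_mult to_ac_sum)

lemma lift_power: "lift (p ^ n) = lift p ^ n"
  by (induction n) (simp_all add: lift_mult)

lemma lift_inj: "lift p = lift q \<longleftrightarrow> p = q"
  by (auto simp: poly_eq_iff coeff_map_poly)

lemma degree_lift [simp]: "degree (lift p) = degree p"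
  by (rule degree_map_poly) simp

lemma lift_surj:
  assumes "\<And>i. coeff p i \<in> GF r"
  obtains p' where "p = lift p'"
proof
  have "to_ac (of_ac (coeff p i)) = coeff p i" for i
    using assms[of i] by (intro to_ac_of_ac) (simp add: range_to_ac)
  then show "p = lift (map_poly of_ac p)"
    by (intro poly_eqI) (simp add: coeff_map_poly)
qed

lemma poly_lift_conj: "poly (lift p) (x ^ (2 ^ (r * i))) = poly (lift p) x ^ (2 ^ (r * i))"
proof -
  have c: "to_ac c ^ (2 ^ (r * i)) = to_ac c" for c :: 'a
    by (rule GF_mult_power) (simp flip: range_to_ac)
  have "(x ^ (2 ^ (r * i))) ^ j = (x ^ j) ^ (2 ^ (r * i))" for j
    by (simp add: mult.commute flip: power_mult)
  then show ?thesis
    by (simp add: poly_altdef coeff_map_poly pow2_sum power_mult_distrib c)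
qed

lemma poly_lift_conj_0: "poly (lift p) (x ^ (2 ^ (r * i))) = 0 \<longleftrightarrow> poly (lift p) x = 0"
  by (simp add: poly_lift_conj)

text \<open>The product of \<open>X - \<alpha>\<^sub>i\<close> over the first \<open>k\<close> Frobenius iterates \<open>\<alpha>\<^sub>i\<close> of \<open>\<alpha>\<close>; signs are irrelevant
  in characteristic 2. For \<open>\<alpha>\<close> in \<open>GF (r * k)\<close> it is the characteristic polynomial of \<open>\<alpha>\<close> over
  the base field.\<close>

definition orbit_poly :: "nat \<Rightarrow> 'a alg_closure \<Rightarrow> 'a alg_closure poly" where
  "orbit_poly k \<alpha> = (\<Prod>i<k. [:\<alpha> ^ (2 ^ (r * i)), 1:])"

lemma orbit_poly_Suc: "orbit_poly (Suc k) \<alpha> = orbit_poly k \<alpha> * [:\<alpha> ^ (2 ^ (r * k)), 1:]"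
  by (simp only: orbit_poly_def prod.lessThan_Suc)

lemma degree_orbit_poly [simp]: "degree (orbit_poly k \<alpha>) = k"
  by (simp add: orbit_poly_def degree_prod_sum_eq)

lemma lead_coeff_orbit_poly: "coeff (orbit_poly k \<alpha>) k = 1"
proof -
  have "lead_coeff (orbit_poly k \<alpha>) = 1"
    by (simp only: orbit_poly_def lead_coeff_prod) simp
  then show ?thesis by simp
qed

lemma reflect_orbit_poly: "coeff (reflect_poly (orbit_poly k \<alpha>)) j = esym j k (\<lambda>i. \<alpha> ^ (2 ^ (r * i)))"
proof -
  have "reflect_poly [:a, 1:] = [:1, a:]" for a :: "'a alg_closure"
    by (cases "a = 0") (simp_all add: reflect_poly_pCons reflect_poly_pCons')
  then show ?thesis by (simp add: orbit_poly_def esym_def reflect_poly_prod)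
qed

lemma orbit_poly_descends:
  assumes "\<alpha> \<in> GF (r * k)"
  obtains M where "orbit_poly k \<alpha> = lift M" "lead_coeff M = 1" "degree M = k"
proof -
  have "coeff (orbit_poly k \<alpha>) j \<in> GF r" for j
  proof (cases "j \<le> k")
    case True
    then have "coeff (orbit_poly k \<alpha>) j = coeff (reflect_poly (orbit_poly k \<alpha>)) (k - j)"
      by (simp add: coeff_reflect_poly)
    then show ?thesis by (simp only: reflect_orbit_poly esym_conj_GF[OF assms])
  next
    case False
    then show ?thesis by (simp add: coeff_eq_0)
  qed
  then obtain M where M: "orbit_poly k \<alpha> = lift M" using lift_surj by blast
  have d: "degree M = k" by (metis M degree_lift degree_orbit_poly)
  have "to_ac (coeff M k) = 1"
    using lead_coeff_orbit_poly[of k \<alpha>] by (simp add: M coeff_map_poly)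
  then show ?thesis using that M d by simp
qed

lemma poly_orbit_poly: "poly (orbit_poly k \<alpha>) x = 0 \<longleftrightarrow> (\<exists>i<k. x = \<alpha> ^ (2 ^ (r * i)))"
  by (auto simp: orbit_poly_def poly_prod)

lemma poly_dvd_1: "p dvd 1 \<longleftrightarrow> p \<noteq> 0 \<and> degree p = 0" for p :: "'a poly"
  by (cases "p = 0") (auto simp: is_unit_iff_degree)

text \<open>Frobenius maps the finitely many roots of \<open>p\<close> injectively to themselves, so each root returns to
  itself.\<close>

lemma algebraic_period:
  assumes "p \<noteq> 0" "poly (lift p) \<alpha> = 0"
  obtains k where "k > 0" "\<alpha> \<in> GF (r * k)"
proof -
  let ?f = "\<lambda>i. \<alpha> ^ (2 ^ (r * i))"
  have "lift p \<noteq> 0" using assms(1) lift_inj[of p 0] by simp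
  then have "finite {x. poly (lift p) x = 0}" by (rule poly_roots_finite)
  moreover have "range ?f \<subseteq> {x. poly (lift p) x = 0}"
    using assms(2) by (auto simp: poly_lift_conj_0)
  ultimately have "finite (range ?f)" using finite_subset by blast
  then have "\<not> inj ?f" using finite_imageD by blast
  then obtain i j where ij: "i < j" "?f i = ?f j"
    unfolding inj_def by (metis linorder_neqE_nat)
  have "?f (i + (j - i)) = (?f (j - i)) ^ (2 ^ (r * i))"
    by (simp add: pow2_pow2 distrib_left add.commute)
  then have "?f (j - i) ^ (2 ^ (r * i)) = \<alpha> ^ (2 ^ (r * i))" using ij by simp
  then have "?f (j - i) = \<alpha>" by (simp only: pow2_inj)
  then show ?thesis using that[of "j - i"] ij by (simp add: GF_def)
qed

text \<open>The minimal polynomial \<open>M\<close> of \<open>\<alpha>\<close> is the orbit polynomial for the exact Frobenius period \<open>m\<close>, and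
  going around the orbit several times produces the powers of \<open>M\<close>.\<close>

lemma minimal_poly:
  assumes k: "k > 0" "\<alpha> \<in> GF (r * k)"
  obtains m M where "m > 0" "\<alpha> \<in> GF (r * m)" "lead_coeff M = 1" "degree M = m" "irreducible M"
    "lift M = orbit_poly m \<alpha>" "card {x. poly (lift M) x = 0} = m"
    "\<forall>N. poly (lift N) \<alpha> = 0 \<longrightarrow> M dvd N"
    "\<forall>n. \<alpha> \<in> GF (r * n) \<longrightarrow> m dvd n"
    "\<forall>n. m dvd n \<longrightarrow> orbit_poly n \<alpha> = lift (M ^ (n div m))"
proof -
  let ?f = "\<lambda>i. \<alpha> ^ (2 ^ (r * i))"
  define m where "m = (LEAST k. k > 0 \<and> \<alpha> \<in> GF (r * k))"
  have m: "m > 0" "\<alpha> \<in> GF (r * m)"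
    using LeastI[of "\<lambda>k. k > 0 \<and> \<alpha> \<in> GF (r * k)" k] k unfolding m_def by auto
  have min: "m \<le> k" if "k > 0" "\<alpha> \<in> GF (r * k)" for k
    using that unfolding m_def by (intro Least_le) auto
  have per: "?f (i + m * l) = ?f i" for i l
  proof -
    have "?f (i + m * l) = (\<alpha> ^ (2 ^ (r * m * l))) ^ (2 ^ (r * i))"
      by (simp add: pow2_pow2 distrib_left add.commute mult.assoc)
    then show ?thesis using GF_mult_power[OF m(2), of l] by simp
  qed
  have inj: "inj_on ?f {..<m}"
  proof -
    have False if "i < j" "j < m" "?f i = ?f j" for i j
    proof -
      have "?f (i + (j - i)) = (?f (j - i)) ^ (2 ^ (r * i))"
        by (simp add: pow2_pow2 distrib_left add.commute)
      then have "?f (j - i) ^ (2 ^ (r * i)) = \<alpha> ^ (2 ^ (r * i))" using that by simp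
      then have "?f (j - i) = \<alpha>" by (simp only: pow2_inj)
      then show False using min[of "j - i"] that by (simp add: GF_def)
    qed
    then show ?thesis unfolding inj_on_def by (metis lessThan_iff linorder_neqE_nat)
  qed
  obtain M where M: "orbit_poly m \<alpha> = lift M" "lead_coeff M = 1" "degree M = m"
    using orbit_poly_descends[OF m(2)] by blast
  have M0: "M \<noteq> 0" using M(2) by auto
  have roots: "{x. poly (lift M) x = 0} = ?f ` {..<m}"
    by (auto simp: M(1)[symmetric] poly_orbit_poly)
  have card: "card {x. poly (lift M) x = 0} = m"
    using card_image[OF inj] by (simp add: roots)
  have root: "poly (lift M) \<alpha> = 0"
    using m(1) by (auto simp: M(1)[symmetric] poly_orbit_poly intro!: exI[of _ 0])
  have dvd: "M dvd N" if N: "poly (lift N) \<alpha> = 0" for N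
  proof -
    define R where "R = N mod M"
    have NR: "N = N div M * M + R" by (simp add: R_def)
    have "lift N = lift (N div M) * lift M + lift R"
      by (subst NR) (rule poly_eqI, simp add: coeff_map_poly flip: lift_mult)
    then have "poly (lift R) \<alpha> = 0" using N root by simp
    then have sub: "?f ` {..<m} \<subseteq> {x. poly (lift R) x = 0}" by (auto simp: poly_lift_conj_0)
    \<comment> \<open>\<open>R\<close> vanishes on the whole orbit, which has \<open>m > degree R\<close> elements.\<close>
    have "R = 0"
    proof (rule ccontr)
      assume R: "R \<noteq> 0"
      then have "lift R \<noteq> 0" using lift_inj[of R 0] by simp
      then have "card (?f ` {..<m}) \<le> degree R"
        using sub card_poly_roots_bound[of "lift R"] card_mono[OF poly_roots_finite sub] by simp
      moreover have "degree R < m"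
        using degree_mod_less[OF M0, of N] R by (simp add: R_def M(3))
      ultimately show False using card_image[OF inj] by simp
    qed
    then show ?thesis by (simp add: R_def mod_eq_0_iff_dvd)
  qed
  have irr: "irreducible M"
  proof (rule irreducibleI)
    show "M \<noteq> 0" using M(2) by auto
    show "\<not> M dvd 1" using M(3) m(1) by (simp add: poly_dvd_1)
    fix A B assume AB: "M = A * B"
    have nz: "A \<noteq> 0" "B \<noteq> 0" using AB M(2) by auto
    have "poly (lift A) \<alpha> * poly (lift B) \<alpha> = 0" using root by (simp add: AB lift_mult)
    then have "M dvd A \<or> M dvd B" using dvd by auto
    then have "A * B dvd A * 1 \<or> A * B dvd 1 * B" by (simp only: AB mult_1_left mult_1_right)
    then show "A dvd 1 \<or> B dvd 1"
      unfolding dvd_mult_cancel_left dvd_mult_cancel_right using nz by blast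
  qed
  have per_dvd: "m dvd n" if n: "\<alpha> \<in> GF (r * n)" for n
  proof -
    have "?f (n mod m) = ?f (n mod m + m * (n div m))" by (rule per[symmetric])
    also have "\<dots> = \<alpha>" using n by (simp add: GF_def)
    finally have "\<alpha> \<in> GF (r * (n mod m))" by (simp add: GF_def)
    then have "n mod m = 0" using min[of "n mod m"] m(1) by (meson mod_less_divisor not_le neq0_conv)
    then show ?thesis by auto
  qed
  have pow: "orbit_poly (m * l) \<alpha> = lift (M ^ l)" for l
  proof (induction l)
    case (Suc l)
    have "orbit_poly (m * l + m') \<alpha> = orbit_poly (m * l) \<alpha> * orbit_poly m' \<alpha>" for m'
    proof (induction m')
      case (Suc m')
      have "?f (m * l + m') = ?f m'" using per[of m' l] by (simp only: add.commute)
      then show ?case by (simp only: add_Suc_right orbit_poly_Suc Suc mult.assoc)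
    qed (simp add: orbit_poly_def)
    from this[of m] have "orbit_poly (m * Suc l) \<alpha> = lift (M ^ l) * lift M"
      by (simp only: Suc M(1) mult_Suc_right add.commute[of m "m * l"])
    then show ?case by (simp add: lift_mult mult.commute)
  qed (simp add: orbit_poly_def)
  have pow': "orbit_poly n \<alpha> = lift (M ^ (n div m))" if "m dvd n" for n
    using pow[of "n div m"] that by simp
  show ?thesis
    using that[OF m M(2,3) irr M(1)[symmetric] card] dvd per_dvd pow' by blast
qed

lemma monic_irreducible_eq:
  fixes M P :: "'a poly"
  assumes "lead_coeff M = 1" "lead_coeff P = 1" "irreducible P" "degree M > 0" "M dvd P"
  shows "M = P"
proof -
  obtain U where U: "P = M * U" using assms(5) by (auto elim: dvdE)
  have "\<not> M dvd 1" using assms(4) by (simp add: poly_dvd_1)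
  then have "U dvd 1" using assms(3) U irreducibleD by blast
  then have "degree U = 0" by (simp add: poly_dvd_1)
  then obtain u where u: "U = [:u:]" by (auto elim: degree_eq_zeroE)
  have "lead_coeff P = lead_coeff M * lead_coeff U" by (simp only: U lead_coeff_mult)
  then have "u = 1" using assms(1,2) u by simp
  then show ?thesis using U u by (simp add: one_pCons[symmetric])
qed

lemma root_of_irreducible:
  assumes P: "lead_coeff P = 1" "irreducible P" and \<alpha>: "poly (lift P) \<alpha> = 0"
  shows "\<alpha> \<in> GF (r * degree P)" "card {x. poly (lift P) x = 0} = degree P"
    "\<And>N. poly (lift N) \<alpha> = 0 \<Longrightarrow> P dvd N"
    "\<And>n. degree P dvd n \<Longrightarrow> orbit_poly n \<alpha> = lift (P ^ (n div degree P))"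
proof -
  have "P \<noteq> 0" using P by auto
  then obtain k where k: "k > 0" "\<alpha> \<in> GF (r * k)" using algebraic_period \<alpha> by blast
  obtain m M where M: "m > 0" "\<alpha> \<in> GF (r * m)" "lead_coeff M = 1" "degree M = m" "irreducible M"
    "lift M = orbit_poly m \<alpha>" "card {x. poly (lift M) x = 0} = m"
    "\<forall>N. poly (lift N) \<alpha> = 0 \<longrightarrow> M dvd N"
    "\<forall>n. \<alpha> \<in> GF (r * n) \<longrightarrow> m dvd n"
    "\<forall>n. m dvd n \<longrightarrow> orbit_poly n \<alpha> = lift (M ^ (n div m))"
    by (rule minimal_poly[OF k]) (rule that)
  have MP: "M = P"
    by (rule monic_irreducible_eq[OF M(3) P]) (use M(1,4) M(8)[rule_format, OF \<alpha>] in simp_all)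
  have m: "m = degree P" using M(4) MP by simp
  show "\<alpha> \<in> GF (r * degree P)" using M(2) by (simp only: m)
  show "card {x. poly (lift P) x = 0} = degree P" using M(7) by (simp only: m MP)
  show "P dvd N" if "poly (lift N) \<alpha> = 0" for N using M(8)[rule_format, OF that] by (simp only: MP)
  show "orbit_poly n \<alpha> = lift (P ^ (n div degree P))" if "degree P dvd n" for n
    using M(10)[rule_format, of n] that by (simp only: m MP)
qed

lemma prime_power_unique:
  assumes "is_monic_prime_power f P" "is_monic_prime_power f P'"
  shows "P' = (P :: 'a poly)"
proof -
  obtain k k' where P: "lead_coeff P = 1" "irreducible P" "k \<ge> 1" "f = P ^ k"
    and P': "lead_coeff P' = 1" "irreducible P'" "k' \<ge> 1" "f = P' ^ k'"
    using assms unfolding is_monic_prime_power_def by blast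
  have deg: "degree P > 0" using P(1,2) by (auto simp: irreducible_def poly_dvd_1)
  then obtain \<alpha> where \<alpha>: "poly (lift P) \<alpha> = 0"
    using alg_closed_imp_poly_has_root[of "lift P"] by auto
  have "poly (lift f) \<alpha> = 0" using P(3,4) \<alpha> by (simp add: lift_power)
  then have "poly (lift P') \<alpha> = 0" by (simp add: P'(4) lift_power)
  then have "P dvd P'" using root_of_irreducible(3)[OF P(1,2) \<alpha>] by blast
  then show ?thesis using monic_irreducible_eq[OF P(1) P'(1,2) deg] by simp
qed

text \<open>The von Mangoldt function counts the elements with a given characteristic polynomial: if
  \<open>f = P\<^sup>k\<close>, they are the \<open>degree P\<close> roots of \<open>P\<close>; and a characteristic polynomial is always a power
  of an irreducible one.\<close>

lemma card_orbit_poly_fibre: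
  fixes f :: "'a poly"
  assumes n: "n > 0" and f: "f \<in> monic_polys n"
  shows "card {\<alpha> \<in> GF (r * n). orbit_poly n \<alpha> = lift f} = poly_mangoldt f"
proof (cases "\<exists>P. is_monic_prime_power f P")
  case True
  then obtain P where PP: "is_monic_prime_power f P" by blast
  have "(THE P. is_monic_prime_power f P) = P"
    using PP by (rule the_equality) (rule prime_power_unique[OF PP])
  then have mang: "poly_mangoldt f = degree P"
    using True by (simp add: poly_mangoldt_def)
  obtain k where P: "lead_coeff P = 1" "irreducible P" "k \<ge> 1" "f = P ^ k"
    using PP unfolding is_monic_prime_power_def by blast
  have deg: "degree P > 0" using P(1,2) by (auto simp: irreducible_def poly_dvd_1)
  have nk: "n = degree P * k"
  proof -
    have "P \<noteq> 0" using P(1) by auto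
    then show ?thesis using f by (simp add: monic_polys_def P(4) Polynomial.degree_power_eq mult.commute)
  qed
  have "{\<alpha> \<in> GF (r * n). orbit_poly n \<alpha> = lift f} = {x. poly (lift P) x = 0}"
  proof (intro equalityI subsetI; clarify)
    fix \<alpha> assume "orbit_poly n \<alpha> = lift f"
    moreover have "poly (orbit_poly n \<alpha>) \<alpha> = 0"
      using n by (auto simp: poly_orbit_poly intro!: exI[of _ 0])
    ultimately show "poly (lift P) \<alpha> = 0" by (simp add: P(4) lift_power)
  next
    fix \<alpha> assume a: "poly (lift P) \<alpha> = 0"
    note R = root_of_irreducible[OF P(1,2) a]
    have "\<alpha> \<in> GF (r * n)" by (rule GF_mono[OF R(1)]) (simp add: nk)
    moreover have "orbit_poly n \<alpha> = lift f" using R(4)[of n] deg by (simp add: nk P(4))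
    ultimately show "\<alpha> \<in> GF (r * n) \<and> orbit_poly n \<alpha> = lift f" ..
  qed
  moreover obtain \<alpha> where "poly (lift P) \<alpha> = 0"
    using alg_closed_imp_poly_has_root[of "lift P"] deg by auto
  ultimately show ?thesis using root_of_irreducible(2)[OF P(1,2)] mang by simp
next
  case False
  have "orbit_poly n \<alpha> \<noteq> lift f" if a: "\<alpha> \<in> GF (r * n)" for \<alpha>
  proof
    assume eq: "orbit_poly n \<alpha> = lift f"
    obtain m M where M: "m > 0" "\<alpha> \<in> GF (r * m)" "lead_coeff M = 1" "degree M = m" "irreducible M"
      "lift M = orbit_poly m \<alpha>" "card {x. poly (lift M) x = 0} = m"
      "\<forall>N. poly (lift N) \<alpha> = 0 \<longrightarrow> M dvd N"
      "\<forall>n. \<alpha> \<in> GF (r * n) \<longrightarrow> m dvd n"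
      "\<forall>n. m dvd n \<longrightarrow> orbit_poly n \<alpha> = lift (M ^ (n div m))"
      by (rule minimal_poly[OF n a]) (rule that)
    note dvd = M(9)[rule_format, OF a]
    have "f = M ^ (n div m)" using M(10)[rule_format, OF dvd] eq by (simp add: lift_inj)
    moreover have "n div m \<ge> 1" using M(1) dvd n by (auto elim!: dvdE)
    ultimately show False using False M(3,5) by (auto simp: is_monic_prime_power_def)
  qed
  then have "{\<alpha> \<in> GF (r * n). orbit_poly n \<alpha> = lift f} = {}" by auto
  moreover have "poly_mangoldt f = 0" unfolding poly_mangoldt_def by (rule if_not_P[OF False])
  ultimately show ?thesis by (simp only: card.empty)
qed

lemma finite_monic_polys: "finite (monic_polys n :: 'a poly set)"
proof (rule finite_subset)
  show "(monic_polys n :: 'a poly set) \<subseteq> Poly ` {xs. set xs \<subseteq> UNIV \<and> length xs = Suc n}"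
  proof
    fix f :: "'a poly" assume f: "f \<in> monic_polys n"
    then have "f \<noteq> 0" by (auto simp: monic_polys_def)
    then have "length (coeffs f) = Suc n" using f by (simp add: length_coeffs_degree monic_polys_def)
    then show "f \<in> Poly ` {xs. set xs \<subseteq> UNIV \<and> length xs = Suc n}"
      by (intro image_eqI[of _ _ "coeffs f"]) auto
  qed
  show "finite (Poly ` {xs :: 'a list. set xs \<subseteq> UNIV \<and> length xs = Suc n})"
    by (intro finite_imageI finite_lists_length_eq) simp
qed

lemma psi_eq_card:
  fixes t1 t2 t3 :: 'a
  assumes n: "n > 0"
  defines "e \<equiv> \<lambda>j \<alpha>. esym j n (\<lambda>i. \<alpha> ^ (2 ^ (r * i)))"
  shows "psi n t1 t2 t3 =
    card {\<alpha> \<in> GF (r * n). e 1 \<alpha> = to_ac t1 \<and> e 2 \<alpha> = to_ac t2 \<and> e 3 \<alpha> = to_ac t3}"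
proof -
  define S where "S = {f. f \<in> monic_polys n \<and> next_to_leading_coeff 1 f = t1 \<and>
    next_to_leading_coeff 2 f = t2 \<and> next_to_leading_coeff 3 f = t3}"
  define A where "A = (\<lambda>f. {\<alpha> \<in> GF (r * n). orbit_poly n \<alpha> = lift f})"
  have ntl: "to_ac (next_to_leading_coeff j f) = e j \<alpha>" if "orbit_poly n \<alpha> = lift f" for j f \<alpha>
  proof -
    have "e j \<alpha> = coeff (reflect_poly (lift f)) j"
      by (simp only: e_def reflect_orbit_poly[symmetric] that)
    then show ?thesis
      by (simp add: next_to_leading_coeff_def coeff_reflect_poly coeff_map_poly)
  qed
  have fin: "finite S" unfolding S_def using finite_monic_polys by (auto intro: finite_subset)
  have finA: "finite (A f)" for f
    using n r_pos finite_GF[of "r * n"] by (auto simp: A_def)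
  have "psi n t1 t2 t3 = (\<Sum>f\<in>S. card (A f))"
    unfolding psi_def S_def[symmetric] A_def
    by (intro sum.cong refl card_orbit_poly_fibre[symmetric] n) (simp add: S_def)
  also have "\<dots> = card (\<Union>f\<in>S. A f)"
    using fin finA by (intro card_UN_disjoint[symmetric]) (auto simp: A_def lift_inj)
  also have "(\<Union>f\<in>S. A f) =
    {\<alpha> \<in> GF (r * n). e 1 \<alpha> = to_ac t1 \<and> e 2 \<alpha> = to_ac t2 \<and> e 3 \<alpha> = to_ac t3}"
  proof (intro equalityI subsetI)
    fix \<alpha> assume "\<alpha> \<in> (\<Union>f\<in>S. A f)"
    then show "\<alpha> \<in> {\<alpha> \<in> GF (r * n). e 1 \<alpha> = to_ac t1 \<and> e 2 \<alpha> = to_ac t2 \<and> e 3 \<alpha> = to_ac t3}"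
      by (auto simp: S_def A_def simp flip: ntl)
  next
    fix \<alpha> assume a: "\<alpha> \<in> {\<alpha> \<in> GF (r * n). e 1 \<alpha> = to_ac t1 \<and> e 2 \<alpha> = to_ac t2 \<and> e 3 \<alpha> = to_ac t3}"
    then obtain f where f: "orbit_poly n \<alpha> = lift f" "lead_coeff f = 1" "degree f = n"
      using orbit_poly_descends[of \<alpha> n] by auto
    have "to_ac (next_to_leading_coeff 1 f) = to_ac t1"
      "to_ac (next_to_leading_coeff 2 f) = to_ac t2" "to_ac (next_to_leading_coeff 3 f) = to_ac t3"
      using a unfolding ntl[OF f(1)] by simp_all
    then have "f \<in> S" "\<alpha> \<in> A f"
      using a f by (auto simp: S_def A_def monic_polys_def)
    then show "\<alpha> \<in> (\<Union>f\<in>S. A f)" by blast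
  qed
  finally show ?thesis .
qed

end

section \<open>The explicit formula\<close>

theorem corollary1p5:
  fixes q r :: nat and t\<^sub>1 t\<^sub>2 t\<^sub>3 :: "'a::{field,finite}"
  assumes "r \<ge> 1" and "q = 2 ^ r" and "CARD('a) = q"
  shows "int (psi 24 t\<^sub>1 t\<^sub>2 t\<^sub>3) =
    int q ^ 21 - int q ^ 10 *
      (2 * int q ^ 2 * of_bool (t\<^sub>1 = 0 \<and> t\<^sub>2 = 0 \<and> t\<^sub>3 = 0)
       - int q * of_bool (t\<^sub>1 = 0 \<and> t\<^sub>2 = 0)
       - of_bool (t\<^sub>1 = 0))"
proof -
  have r: "r > 0" using assms(1) by simp
  interpret finite_field_two "TYPE('a)" r
    by unfold_locales (use assms r in auto)
  have t: "to_ac t \<in> GF r" for t :: 'a by (simp flip: range_to_ac)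
  have q: "(2::int) ^ r = int q" by (simp add: assms(2))
  have "int (psi 24 t\<^sub>1 t\<^sub>2 t\<^sub>3) = int (card {\<alpha> \<in> GF (r * 24).
      esym 1 24 (\<lambda>i. \<alpha> ^ (2 ^ (r * i))) = to_ac t\<^sub>1 \<and> esym 2 24 (\<lambda>i. \<alpha> ^ (2 ^ (r * i))) = to_ac t\<^sub>2 \<and>
      esym 3 24 (\<lambda>i. \<alpha> ^ (2 ^ (r * i))) = to_ac t\<^sub>3})"
    by (subst psi_eq_card) simp_all
  also have "\<dots> = int q ^ 21 - int q ^ 10 *
      (2 * (int q)\<^sup>2 * of_bool (to_ac t\<^sub>1 = 0 \<and> to_ac t\<^sub>2 = 0 \<and> to_ac t\<^sub>3 = 0)
       - int q * of_bool (to_ac t\<^sub>1 = 0 \<and> to_ac t\<^sub>2 = 0) - of_bool (to_ac t\<^sub>1 = 0))"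
    by (rule esym_count[OF r t t t, unfolded q])
  finally show ?thesis by simp
qed

end
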